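(* Let $M=\mathbb{S}^3\times\mathbb{S}^1$. There exist a finite alphabet $S$, with full two-sided shift space $\Sigma=S^{\mathbb{Z}}$, and a locally constant cocycle $\mathcal{A}:\Sigma\to\mathrm{Diff}^\infty(M)$ such that the suspension $F:\Sigma\times M\to\Sigma\times M$ of $\mathcal{A}$ preserves a Borel probability measure $\mu$ with non-zero top fiber Lyapunov exponent, and such that every $F$-invariant Borel probability measure $\nu$ supported over a periodic orbit of $\Sigma$ has zero fiber Lyapunov exponents.
   Context: $\mathrm{Diff}^\infty(M)$ is the group of $C^\infty$ diffeomorphisms of the compact manifold $M$, on which a Riemannian metric is fixed. For a finite set $S$, $\Sigma=S^{\mathbb{Z}}$ carries the product topology and $\sigma:\Sigma\to\Sigma$, $\sigma((b_i)_{i\in\mathbb{Z}})=(b_{i+1})_{i\in\mathbb{Z}}$, is the shift. A $\mathrm{Diff}^\infty(M)$-cocycle over $\sigma$ is a continuous map $\mathcal{A}:\Sigma\to\mathrm{Diff}^\infty(M)$; it is locally constant if it is locally constant as a function on $\Sigma$. Its suspension is the map $F(x,p)=(\sigma(x),\mathcal{A}(x)(p))$ on $\Sigma\times M$. For $n\ge 1$ write $\mathcal{A}^n(x)=\mathcal{A}(\sigma^{n-1}x)\circ\cdots\circ\mathcal{A}(\sigma x)\circ\mathcal{A}(x)$. For an $F$-invariant Borel probability measure $\mu$, the fiber Lyapunov exponents at $\mu$-a.e. $(x,p)$ are the Lyapunov exponents, given by Oseledets' theorem, of the linear cocycle over $F$ given by the fiber derivative $D_p(\mathcal{A}(x)):T_pM\to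 T_{\mathcal{A}(x)(p)}M$. The top fiber Lyapunov exponent of $\mu$ is $$\lim_{n\to\infty}\frac1n\int_{\Sigma\times M}\log\|D_p(\mathcal{A}^n(x))\|\,d\mu(x,p),$$ i.e. the $\mu$-average of the largest fiber exponent (its a.e. constant value when $\mu$ is ergodic). A measure $\nu$ has zero fiber Lyapunov exponents if all fiber exponents vanish at $\nu$-a.e. point. An $F$-invariant measure $\nu$ is supported over a periodic orbit of $\Sigma$ if its projection to $\Sigma$ is supported on a single periodic orbit of $\sigma$. *)

theory Defs
  imports "HOL-Probability.Probability"
begin

section \<open>Smooth maps on subsets of Euclidean space\<close>

text \<open>
  \<open>Ck_on k U f\<close> is meant for open \<open>U\<close>: all iterated directional derivatives of \<open>f\<close>
  of order at most \<open>k\<close> exist and are continuous on \<open>U\<close>.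
\<close>

primrec Ck_on ::
  "nat \<Rightarrow> 'a::euclidean_space set \<Rightarrow> ('a \<Rightarrow> 'b::euclidean_space) \<Rightarrow> bool" where
  "Ck_on 0 U f \<longleftrightarrow> continuous_on U f"
| "Ck_on (Suc k) U f \<longleftrightarrow>
     (\<forall>x\<in>U. f differentiable (at x)) \<and>
     (\<forall>v. Ck_on k U (\<lambda>x. frechet_derivative f (at x) v))"

definition smooth_on_open ::
  "'a::euclidean_space set \<Rightarrow> ('a \<Rightarrow> 'b::euclidean_space) \<Rightarrow> bool" where
  "smooth_on_open U f \<longleftrightarrow> open U \<and> (\<forall>k. Ck_on k U f)"

text \<open>
  Smoothness on an embedded submanifold \<open>N\<close>: local extendability to smooth maps
  on open subsets of the ambient space. Only the values of \<open>f\<close> on \<open>N\<close> matter.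
\<close>

definition smooth_map_on ::
  "'a::euclidean_space set \<Rightarrow> ('a \<Rightarrow> 'b::euclidean_space) \<Rightarrow> bool" where
  "smooth_map_on N f \<longleftrightarrow>
     (\<forall>p\<in>N. \<exists>U h. p \<in> U \<and> smooth_on_open U h \<and> (\<forall>q\<in>U \<inter> N. h q = f q))"

text \<open>Elements of the diffeomorphism group are represented up to equality on \<open>N\<close>.\<close>

definition smooth_diffeo :: "'a::euclidean_space set \<Rightarrow> ('a \<Rightarrow> 'a) \<Rightarrow> bool" where
  "smooth_diffeo N f \<longleftrightarrow>
     bij_betw f N N \<and> smooth_map_on N f \<and> smooth_map_on N (inv_into N f)"


section \<open>The manifold and its Riemannian metrics\<close>

type_synonym ambient = "(real ^ 4) \<times> (real ^ 2)"

definition S3xS1 :: "ambient set" where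
  "S3xS1 = sphere 0 1 \<times> sphere 0 1"

definition tangent_space :: "ambient \<Rightarrow> ambient set" where
  "tangent_space p = {v. fst v \<bullet> fst p = 0 \<and> snd v \<bullet> snd p = 0}"

definition smooth_vector_field :: "(ambient \<Rightarrow> ambient) \<Rightarrow> bool" where
  "smooth_vector_field X \<longleftrightarrow>
     smooth_map_on S3xS1 X \<and> (\<forall>p\<in>S3xS1. X p \<in> tangent_space p)"

definition riemannian_metric :: "(ambient \<Rightarrow> ambient \<Rightarrow> ambient \<Rightarrow> real) \<Rightarrow> bool" where
  "riemannian_metric g \<longleftrightarrow>
     (\<forall>p\<in>S3xS1. \<forall>u\<in>tangent_space p. \<forall>v\<in>tangent_space p. \<forall>w\<in>tangent_space p. \<forall>a.
        g p (a *\<^sub>R u + v) w = a * g p u w + g p v w) \<and>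
     (\<forall>p\<in>S3xS1. \<forall>u\<in>tangent_space p. \<forall>v\<in>tangent_space p. g p u v = g p v u) \<and>
     (\<forall>p\<in>S3xS1. \<forall>u\<in>tangent_space p. u \<noteq> 0 \<longrightarrow> g p u u > 0) \<and>
     (\<forall>X Y. smooth_vector_field X \<and> smooth_vector_field Y \<longrightarrow>
        smooth_map_on S3xS1 (\<lambda>p. g p (X p) (Y p)))"

definition metric_norm ::
  "(ambient \<Rightarrow> ambient \<Rightarrow> ambient \<Rightarrow> real) \<Rightarrow> ambient \<Rightarrow> ambient \<Rightarrow> real" where
  "metric_norm g p v = sqrt (g p v v)"

text \<open>
  A derivative of \<open>f\<close> at \<open>p\<close> within \<open>S3xS1\<close> is a linear map on the ambient space that is
  uniquely determined on \<open>tangent_space p\<close> only; \<open>tangent_map f p v\<close> is therefore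
  meaningful (and used) for \<open>v \<in> tangent_space p\<close>.
\<close>

definition tangent_map :: "(ambient \<Rightarrow> ambient) \<Rightarrow> ambient \<Rightarrow> ambient \<Rightarrow> ambient" where
  "tangent_map f p = frechet_derivative f (at p within S3xS1)"

definition tangent_map_norm ::
  "(ambient \<Rightarrow> ambient \<Rightarrow> ambient \<Rightarrow> real) \<Rightarrow> (ambient \<Rightarrow> ambient) \<Rightarrow> ambient \<Rightarrow> real" where
  "tangent_map_norm g f p =
     (SUP v\<in>{v\<in>tangent_space p. metric_norm g p v = 1}. metric_norm g (f p) (tangent_map f p v))"


section \<open>Cocycles over the full shift\<close>

text \<open>
  Alphabets are finite sets of natural numbers. Since \<open>nat\<close> is discrete, the topology on
  \<open>full_shift S\<close> induced from the type \<open>int \<Rightarrow> nat\<close> (product topology) is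
  the product topology of the discrete topology on \<open>S\<close>.
\<close>

definition full_shift :: "nat set \<Rightarrow> (int \<Rightarrow> nat) set" where
  "full_shift S = {x. \<forall>i. x i \<in> S}"

definition left_shift :: "(int \<Rightarrow> nat) \<Rightarrow> int \<Rightarrow> nat" where
  "left_shift x = (\<lambda>i. x (i + 1))"

type_synonym cocycle = "(int \<Rightarrow> nat) \<Rightarrow> ambient \<Rightarrow> ambient"

text \<open>
  A locally constant map is continuous for every topology on its codomain, so the
  smooth topology on the diffeomorphism group does not have to be mentioned.
\<close>

definition locally_constant_cocycle :: "nat set \<Rightarrow> cocycle \<Rightarrow> bool" where
  "locally_constant_cocycle S A \<longleftrightarrow>
     (\<forall>x\<in>full_shift S. smooth_diffeo S3xS1 (A x)) \<and>
     (\<forall>x\<in>full_shift S. \<exists>U. open U \<and> x \<in> U \<and>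
        (\<forall>y\<in>U \<inter> full_shift S. \<forall>p\<in>S3xS1. A y p = A x p))"

definition suspension :: "cocycle \<Rightarrow> (int \<Rightarrow> nat) \<times> ambient \<Rightarrow> (int \<Rightarrow> nat) \<times> ambient" where
  "suspension A = (\<lambda>(x, p). (left_shift x, A x p))"

primrec cocycle_iterate :: "cocycle \<Rightarrow> nat \<Rightarrow> cocycle" where
  "cocycle_iterate A 0 x = id"
| "cocycle_iterate A (Suc n) x = A ((left_shift ^^ n) x) \<circ> cocycle_iterate A n x"


section \<open>Invariant measures and fiber Lyapunov exponents\<close>

definition invariant_prob :: "nat set \<Rightarrow> cocycle \<Rightarrow> ((int \<Rightarrow> nat) \<times> ambient) measure \<Rightarrow> bool" where
  "invariant_prob S A \<mu> \<longleftrightarrow>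
     prob_space \<mu> \<and>
     space \<mu> = full_shift S \<times> S3xS1 \<and>
     sets \<mu> = sets (restrict_space borel (full_shift S \<times> S3xS1)) \<and>
     suspension A \<in> measurable \<mu> \<mu> \<and>
     distr \<mu> \<mu> (suspension A) = \<mu>"

definition supported_over_periodic_orbit ::
  "nat set \<Rightarrow> ((int \<Rightarrow> nat) \<times> ambient) measure \<Rightarrow> bool" where
  "supported_over_periodic_orbit S \<nu> \<longleftrightarrow>
     (\<exists>x\<in>full_shift S. \<exists>n\<ge>1. (left_shift ^^ n) x = x \<and>
        (AE y in distr \<nu> borel fst. y \<in> {(left_shift ^^ k) x | k. k < n}))"

definition has_top_fiber_exponent ::
  "(ambient \<Rightarrow> ambient \<Rightarrow> ambient \<Rightarrow> real) \<Rightarrow> cocycle \<Rightarrow>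
   ((int \<Rightarrow> nat) \<times> ambient) measure \<Rightarrow> real \<Rightarrow> bool" where
  "has_top_fiber_exponent g A \<mu> l \<longleftrightarrow>
     (\<lambda>n. (\<integral>(x, p). ln (tangent_map_norm g (cocycle_iterate A n x) p) \<partial>\<mu>) / real n)
       \<longlonglongrightarrow> l"

definition has_fiber_exponent ::
  "(ambient \<Rightarrow> ambient \<Rightarrow> ambient \<Rightarrow> real) \<Rightarrow> cocycle \<Rightarrow>
   (int \<Rightarrow> nat) \<Rightarrow> ambient \<Rightarrow> ambient \<Rightarrow> real \<Rightarrow> bool" where
  "has_fiber_exponent g A x p v l \<longleftrightarrow>
     (\<lambda>n. ln (metric_norm g (cocycle_iterate A n x p)
                (tangent_map (cocycle_iterate A n x) p v)) / real n) \<longlonglongrightarrow> l"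

text \<open>
  By Oseledets' theorem, at almost every point every non-zero tangent vector has an
  exponent, and the values attained are the fiber Lyapunov exponents at that point.
\<close>

definition zero_fiber_exponents ::
  "(ambient \<Rightarrow> ambient \<Rightarrow> ambient \<Rightarrow> real) \<Rightarrow> cocycle \<Rightarrow>
   ((int \<Rightarrow> nat) \<times> ambient) measure \<Rightarrow> bool" where
  "zero_fiber_exponents g A \<nu> \<longleftrightarrow>
     (AE (x, p) in \<nu>. \<forall>v\<in>tangent_space p - {0}. has_fiber_exponent g A x p v 0)"

end

theory Submission
  imports Defs
begin

text \<open>
  The cocycle consists of two twists: maps that rotate a point \<open>u\<close> of the
  circle and move a point \<open>y\<close> of the three-sphere by a Lorentz boost, a
  conformal flow with a contracting fixed point \<open>pole\<close> and an expanding fixed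
  point \<open>- pole\<close>. The boosting time is the first coordinate of
  \<open>u\<close>, a linear function on the plane. Twists compose to twists: along an orbit
  the rotation angles add up to the phase, and the boosting time becomes the Birkhoff sum of
  the first coordinate along the orbit of \<open>u\<close>.

  Over a periodic sequence the circle is rotated, once per period, by a fixed angle. The two
  rotation angles are \<open>1\<close> and \<open>4\<close> times an irrational fraction of
  a full turn, so that angle is never trivial (\<open>cos_phase_neq_1\<close>). A Birkhoff
  sum of a linear function over a nontrivial rotation is a geometric sum and hence bounded
  (\<open>drift_periodic_bounded\<close>). The differentials of all iterates and of their
  inverses are therefore bounded along every orbit over a periodic sequence, and all
  exponents vanish (\<open>periodic_zero_exponent\<close>). Periodic orbits fail to see
  hyperbolicity because closing up a sequence does not close up the orbit in the circle; the
  remaining rotation averages the boosting time, an odd function, to zero.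

  A nonperiodic sequence can be adapted to the point of the circle instead. The second
  rotation is, modulo a full turn, a backward rotation, and both are by less than a quarter
  turn. Rotating forward at negative angles and backward at others keeps the point in the
  right half plane, where the boosting time is positive. This rule is an exchange of two
  intervals, that is, a rotation of a shorter circle, with Lebesgue measure as invariant
  measure; its codings are Sturmian sequences. Lifting this measure to the points with
  \<open>y = - pole\<close> gives an invariant measure
  (\<open>invariant_sturm_measure\<close>) whose top exponent is the mean boosting time,
  which is positive (\<open>top_exponent_sturm_measure\<close>,
  \<open>top_exponent_positive\<close>).

  The given Riemannian metric enters only through its comparison with the Euclidean one
  (\<open>metric_norm_comparable\<close>) and through the measurability of the logarithmic
  norm (\<open>measurable_log_norm\<close>).
\<close>

section \<open>Closure properties of smooth maps\<close>

text \<open>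
  The iterated derivatives see only the germs of a map at the points of the open set, so any
  formula for the derivative that is valid on that set may replace
  \<open>frechet_derivative\<close>.
\<close>

lemma Ck_on_SucI:
  assumes "\<And>x. x \<in> U \<Longrightarrow> (f has_derivative f' x) (at x)"
    and "open U" and "\<And>v. Ck_on k U (\<lambda>x. f' x v)"
  shows "Ck_on (Suc k) U f"
proof -
  have cong: "Ck_on k U g \<longleftrightarrow> Ck_on k U h"
    if "\<And>x. x \<in> U \<Longrightarrow> g x = h x" for g h :: "'a \<Rightarrow> 'b" and k
    using that
  proof (induction k arbitrary: g h)
    case 0
    then show ?case by (simp cong: continuous_on_cong)
  next
    case (Suc k)
    have d: "(g has_derivative D) (at x) \<longleftrightarrow> (h has_derivative D) (at x)" if "x \<in> U" for x D
      using has_derivative_transform_within_open[OF _ \<open>open U\<close> that, of g D UNIV h]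
        has_derivative_transform_within_open[OF _ \<open>open U\<close> that, of h D UNIV g] Suc.prems
      by auto
    show ?case
      using Suc.IH[of "\<lambda>x. frechet_derivative g (at x) _" "\<lambda>x. frechet_derivative h (at x) _"] d
      by (simp add: differentiable_def frechet_derivative_def)
  qed
  have "frechet_derivative f (at x) = f' x" if "x \<in> U" for x
    using frechet_derivative_at[OF assms(1)[OF that]] by simp
  then show ?thesis
    using assms cong[of "\<lambda>x. frechet_derivative f (at x) _" "\<lambda>x. f' x _"]
    by (auto simp: differentiable_def)
qed

lemma Ck_on_mono: "Ck_on (Suc k) U f \<Longrightarrow> Ck_on k U f"
proof (induction k arbitrary: f)
  case 0
  then show ?case
    by (simp add: differentiable_imp_continuous_on differentiable_on_def
        differentiable_at_withinI)
qed auto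

lemma Ck_on_const: "open U \<Longrightarrow> Ck_on k U (\<lambda>x. c)"
proof (induction k arbitrary: c)
  case (Suc k)
  show ?case
    by (rule Ck_on_SucI[where f' = "\<lambda>x v. 0"]) (use Suc in auto)
qed auto

lemma Ck_on_linear: "bounded_linear f \<Longrightarrow> open U \<Longrightarrow> Ck_on k U f"
proof (cases k)
  case 0
  assume "bounded_linear f"
  then show ?thesis using 0 by (simp add: linear_continuous_on)
next
  case (Suc j)
  assume "bounded_linear f" "open U"
  then show ?thesis unfolding Suc
    by (intro Ck_on_SucI[where f' = "\<lambda>x. f"] Ck_on_const bounded_linear_imp_has_derivative)
qed

lemma Ck_on_add:
  "Ck_on k U f \<Longrightarrow> Ck_on k U g \<Longrightarrow> open U \<Longrightarrow> Ck_on k U (\<lambda>x. f x + g x)"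
proof (induction k arbitrary: f g)
  case (Suc k)
  show ?case
    by (rule Ck_on_SucI[where
          f' = "\<lambda>x v. frechet_derivative f (at x) v + frechet_derivative g (at x) v"])
      (use Suc in \<open>auto intro!: has_derivative_add Suc.IH simp: frechet_derivative_works\<close>)
qed (auto intro: continuous_intros)

lemma Ck_on_scaleR:
  fixes f :: "'a::euclidean_space \<Rightarrow> real"
  shows "Ck_on k U f \<Longrightarrow> Ck_on k U g \<Longrightarrow> open U \<Longrightarrow> Ck_on k U (\<lambda>x. f x *\<^sub>R g x)"
proof (induction k arbitrary: f g)
  case (Suc k)
  note low = Ck_on_mono[OF Suc.prems(1)] Ck_on_mono[OF Suc.prems(2)]
  show ?case
  proof (rule Ck_on_SucI)
    fix x assume "x \<in> U"
    with Suc.prems show "((\<lambda>x. f x *\<^sub>R g x) has_derivative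
        (\<lambda>v. f x *\<^sub>R frechet_derivative g (at x) v + frechet_derivative f (at x) v *\<^sub>R g x)) (at x)"
      by (auto intro!: has_derivative_scaleR simp: frechet_derivative_works)
  next
    fix v
    show "Ck_on k U (\<lambda>x. f x *\<^sub>R frechet_derivative g (at x) v
        + frechet_derivative f (at x) v *\<^sub>R g x)"
      using Suc low by (auto intro!: Ck_on_add Suc.IH)
  qed (rule Suc.prems)
qed (auto intro: continuous_intros)

lemma Ck_on_exp:
  fixes f :: "'a::euclidean_space \<Rightarrow> real"
  shows "Ck_on k U f \<Longrightarrow> open U \<Longrightarrow> Ck_on k U (\<lambda>x. exp (f x))"
proof (induction k)
  case (Suc k)
  show ?case
  proof (rule Ck_on_SucI)
    fix x assume "x \<in> U"
    with Suc.prems show "((\<lambda>x. exp (f x)) has_derivative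
        (\<lambda>v. exp (f x) *\<^sub>R frechet_derivative f (at x) v)) (at x)"
      by (auto intro!: derivative_eq_intros ext simp: frechet_derivative_works)
  next
    fix v
    show "Ck_on k U (\<lambda>x. exp (f x) *\<^sub>R frechet_derivative f (at x) v)"
      by (rule Ck_on_scaleR) (use Suc Ck_on_mono[OF Suc.prems(1)] in auto)
  qed (rule Suc.prems)
qed (auto intro: continuous_intros)

lemma Ck_on_inverse:
  fixes f :: "'a::euclidean_space \<Rightarrow> real"
  shows "Ck_on k U f \<Longrightarrow> open U \<Longrightarrow> (\<And>x. x \<in> U \<Longrightarrow> f x \<noteq> 0) \<Longrightarrow> Ck_on k U (\<lambda>x. inverse (f x))"
proof (induction k)
  case (Suc k)
  note IH = Suc.IH[OF Ck_on_mono[OF Suc.prems(1)] Suc.prems(2,3)]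
  have D: "Ck_on k U (\<lambda>x. frechet_derivative f (at x) v)" for v
    using Suc.prems by auto
  show ?case
  proof (rule Ck_on_SucI)
    fix x assume "x \<in> U"
    with Suc.prems show "((\<lambda>x. inverse (f x)) has_derivative
        (\<lambda>v. (- 1) *\<^sub>R (inverse (f x) *\<^sub>R inverse (f x) *\<^sub>R frechet_derivative f (at x) v))) (at x)"
      by (auto intro!: derivative_eq_intros ext simp: frechet_derivative_works)
  next
    fix v
    show "Ck_on k U (\<lambda>x. (- 1) *\<^sub>R (inverse (f x) *\<^sub>R inverse (f x) *\<^sub>R frechet_derivative f (at x) v))"
      using IH D Suc.prems(2) by (intro Ck_on_scaleR Ck_on_const)
  qed (rule Suc.prems)
qed (auto intro: continuous_intros)

lemma smooth_map_on_cong: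
  "(\<And>q. q \<in> N \<Longrightarrow> f q = h q) \<Longrightarrow> smooth_map_on N f \<Longrightarrow> smooth_map_on N h"
  by (fastforce simp: smooth_map_on_def)

lemma smooth_map_on_imp_continuous_on:
  assumes "smooth_map_on N f" shows "continuous_on N f"
  unfolding continuous_on_eq_continuous_within
proof
  fix p assume "p \<in> N"
  then obtain U h where U: "p \<in> U" "open U" "continuous_on U h" "\<And>q. q \<in> U \<inter> N \<Longrightarrow> h q = f q"
    using assms unfolding smooth_map_on_def smooth_on_open_def
    by (metis Ck_on.simps(1))
  have "continuous (at p within N) h"
    using U continuous_on_eq_continuous_at continuous_at_imp_continuous_at_within by blast
  moreover obtain e where "e > 0" "ball p e \<subseteq> U"
    using U openE by blast
  ultimately show "continuous (at p within N) f"
    using U \<open>p \<in> N\<close>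
    by (intro continuous_transform_within[of p N h e f]) (auto simp: dist_commute subset_iff)
qed

section \<open>Tangent maps on the product of spheres\<close>

lemma sphere_curve:
  fixes y \<eta> :: "'a::real_inner"
  assumes "norm y = 1" "\<eta> \<bullet> y = 0"
  defines "c \<equiv> \<lambda>t. inverse (sqrt (1 + t\<^sup>2 * (\<eta> \<bullet> \<eta>))) *\<^sub>R (y + t *\<^sub>R \<eta>)"
  shows "c 0 = y" and "norm (c t) = 1" and "(c has_derivative (\<lambda>t. t *\<^sub>R \<eta>)) (at 0)"
proof -
  have "norm (y + t *\<^sub>R \<eta>) = sqrt (1 + t\<^sup>2 * (\<eta> \<bullet> \<eta>))"
    using assms by (simp add: norm_eq_sqrt_inner algebra_simps inner_commute power2_eq_square)
  moreover have "1 + t\<^sup>2 * (\<eta> \<bullet> \<eta>) > 0"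
    by (simp add: add_pos_nonneg)
  ultimately show "norm (c t) = 1" by (simp add: c_def)
  show "c 0 = y" by (simp add: c_def)
  show "(c has_derivative (\<lambda>t. t *\<^sub>R \<eta>)) (at 0)"
    unfolding c_def by (auto intro!: derivative_eq_intros)
qed

text \<open>
  A derivative within the manifold is determined on tangent vectors because every tangent
  vector is the velocity of a curve that stays in the manifold, namely of the radial
  projection of a straight line. Hence any explicit derivative computes
  \<open>tangent_map\<close>.
\<close>

lemma tangent_map_unique:
  assumes p: "p \<in> S3xS1" and v: "v \<in> tangent_space p"
    and D: "(f has_derivative D) (at p within S3xS1)"
  shows "tangent_map f p v = D v"
proof -
  obtain y u \<eta> w where pv: "p = (y, u)" "v = (\<eta>, w)" by (metis surj_pair)
  have s: "norm y = 1" "\<eta> \<bullet> y = 0" "norm u = 1" "w \<bullet> u = 0"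
    using p v by (auto simp: pv S3xS1_def tangent_space_def)
  define c where "c t = (inverse (sqrt (1 + t\<^sup>2 * (\<eta> \<bullet> \<eta>))) *\<^sub>R (y + t *\<^sub>R \<eta>),
     inverse (sqrt (1 + t\<^sup>2 * (w \<bullet> w))) *\<^sub>R (u + t *\<^sub>R w))" for t
  have c0: "c 0 = p" by (simp add: c_def pv)
  have cM: "c t \<in> S3xS1" for t
    using sphere_curve(2)[OF s(1,2)] sphere_curve(2)[OF s(3,4)] by (simp add: c_def S3xS1_def)
  have cd: "(c has_derivative (\<lambda>t. t *\<^sub>R v)) (at 0)"
    unfolding c_def pv scaleR_Pair
    by (intro has_derivative_Pair sphere_curve(3)[OF s(1,2)] sphere_curve(3)[OF s(3,4)])
  have E: "E v = frechet_derivative (f \<circ> c) (at 0) 1" if "(f has_derivative E) (at p within S3xS1)" for E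
  proof -
    have "(f has_derivative E) (at (c 0) within range c)"
      unfolding c0 by (rule has_derivative_subset[OF that]) (use cM in auto)
    from has_derivative_in_compose[OF cd this]
    have "(f \<circ> c has_derivative (\<lambda>t. E (t *\<^sub>R v))) (at 0)"
      by (simp add: o_def)
    from fun_cong[OF frechet_derivative_at[OF this], of 1] show ?thesis by simp
  qed
  have "(f has_derivative tangent_map f p) (at p within S3xS1)"
    using differentiableI[OF D] frechet_derivative_works unfolding tangent_map_def by blast
  from E[OF this] E[OF D] show ?thesis by simp
qed

section \<open>Comparison of Riemannian metrics with the Euclidean one\<close>

text \<open>
  Orthogonal projection to the tangent space. For fixed \<open>w\<close> it is a smooth
  vector field, and the fields obtained from the standard basis span every tangent space.
  This gives access to the smoothness of a Riemannian metric, which is postulated for pairs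
  of vector fields only.
\<close>

definition tangent_proj :: "ambient \<Rightarrow> ambient \<Rightarrow> ambient" where
  "tangent_proj p w = (fst w - (fst w \<bullet> fst p) *\<^sub>R fst p, snd w - (snd w \<bullet> snd p) *\<^sub>R snd p)"

lemma tangent_proj_in: "p \<in> S3xS1 \<Longrightarrow> tangent_proj p w \<in> tangent_space p"
  by (simp add: tangent_proj_def tangent_space_def S3xS1_def mem_Times_iff inner_diff_left dot_square_norm)

lemma tangent_proj_id: "v \<in> tangent_space p \<Longrightarrow> tangent_proj p v = v"
  by (auto simp: tangent_proj_def tangent_space_def)

lemma tangent_proj_linear: "linear (tangent_proj p)"
  by (rule linearI)
    (simp_all add: tangent_proj_def inner_add_left scaleR_add_left scaleR_diff_right)

lemma smooth_vector_field_tangent_proj: "smooth_vector_field (\<lambda>p. tangent_proj p w)"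
proof -
  let ?A = "\<lambda>p::ambient. fst w \<bullet> fst p" and ?B = "\<lambda>p::ambient. snd w \<bullet> snd p"
  have eq: "tangent_proj p w = w + ((- 1) *\<^sub>R (?A p *\<^sub>R (fst p, 0)) + (- 1) *\<^sub>R (?B p *\<^sub>R (0, snd p)))"
    for p by (cases w) (simp add: tangent_proj_def)
  have "Ck_on k UNIV (\<lambda>p. tangent_proj p w)" for k
    unfolding eq
    by (intro Ck_on_add Ck_on_scaleR Ck_on_const Ck_on_linear open_UNIV bounded_linear_Pair
        bounded_linear_fst bounded_linear_snd bounded_linear_zero
        bounded_linear_compose[OF bounded_linear_inner_right bounded_linear_fst]
        bounded_linear_compose[OF bounded_linear_inner_right bounded_linear_snd])
  then have "smooth_map_on S3xS1 (\<lambda>p. tangent_proj p w)"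
    unfolding smooth_map_on_def smooth_on_open_def by blast
  then show ?thesis
    by (simp add: smooth_vector_field_def tangent_proj_in)
qed

lemma tangent_space_linear:
  "0 \<in> tangent_space p" "u \<in> tangent_space p \<Longrightarrow> a *\<^sub>R u \<in> tangent_space p"
  "u \<in> tangent_space p \<Longrightarrow> v \<in> tangent_space p \<Longrightarrow> u + v \<in> tangent_space p"
  by (auto simp: tangent_space_def inner_add_left)

lemma compact_S3xS1: "compact S3xS1"
  by (simp add: S3xS1_def compact_Times)

context
  fixes g assumes g: "riemannian_metric g"
begin

lemma metric_add:
  "p \<in> S3xS1 \<Longrightarrow> u \<in> tangent_space p \<Longrightarrow> v \<in> tangent_space p \<Longrightarrow> w \<in> tangent_space p \<Longrightarrow>
    g p (u + v) w = g p u w + g p v w"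
proof -
  assume *: "p \<in> S3xS1" "u \<in> tangent_space p" "v \<in> tangent_space p" "w \<in> tangent_space p"
  have "g p (1 *\<^sub>R u + v) w = 1 * g p u w + g p v w"
    using g * unfolding riemannian_metric_def by blast
  then show ?thesis by simp
qed

lemma metric_zero: "p \<in> S3xS1 \<Longrightarrow> w \<in> tangent_space p \<Longrightarrow> g p 0 w = 0"
  using metric_add[of p 0 0 w] by (simp add: tangent_space_linear)

lemma metric_scale:
  "p \<in> S3xS1 \<Longrightarrow> u \<in> tangent_space p \<Longrightarrow> w \<in> tangent_space p \<Longrightarrow> g p (a *\<^sub>R u) w = a * g p u w"
proof -
  assume *: "p \<in> S3xS1" "u \<in> tangent_space p" "w \<in> tangent_space p"
  have "g p (a *\<^sub>R u + 0) w = a * g p u w + g p 0 w"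
    using g * tangent_space_linear(1)[of p] unfolding riemannian_metric_def by blast
  then show ?thesis using * by (simp add: metric_zero)
qed

lemma metric_sym:
  "p \<in> S3xS1 \<Longrightarrow> u \<in> tangent_space p \<Longrightarrow> v \<in> tangent_space p \<Longrightarrow> g p u v = g p v u"
  using g unfolding riemannian_metric_def by blast

lemma metric_norm_scale:
  assumes "p \<in> S3xS1" "u \<in> tangent_space p"
  shows "metric_norm g p (a *\<^sub>R u) = \<bar>a\<bar> * metric_norm g p u"
proof -
  have "g p (a *\<^sub>R u) (a *\<^sub>R u) = a * (a * g p u u)"
    by (metis assms metric_scale metric_sym tangent_space_linear(2))
  also have "\<dots> = a\<^sup>2 * g p u u" by (simp add: power2_eq_square)
  finally show ?thesis
    by (simp add: metric_norm_def real_sqrt_mult)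
qed

lemma metric_norm_pos:
  "p \<in> S3xS1 \<Longrightarrow> u \<in> tangent_space p \<Longrightarrow> u \<noteq> 0 \<Longrightarrow> 0 < metric_norm g p u"
  using g unfolding riemannian_metric_def metric_norm_def by simp

lemma metric_sum:
  assumes "p \<in> S3xS1" "w \<in> tangent_space p" "finite I" "\<And>i. i \<in> I \<Longrightarrow> X i \<in> tangent_space p"
  shows "g p (\<Sum>i\<in>I. c i *\<^sub>R X i) w = (\<Sum>i\<in>I. c i * g p (X i) w) \<and> (\<Sum>i\<in>I. c i *\<^sub>R X i) \<in> tangent_space p"
  using assms(3,4)
  by (induction) (auto simp: metric_zero metric_add metric_scale tangent_space_linear assms(1,2))

lemma metric_eq_sum:
  assumes p: "p \<in> S3xS1" and v: "v \<in> tangent_space p"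
  shows "g p v v = (\<Sum>i\<in>Basis. (v \<bullet> i) * (\<Sum>j\<in>Basis. (v \<bullet> j) *
    g p (tangent_proj p j) (tangent_proj p i)))"
proof -
  have "v = tangent_proj p (\<Sum>i\<in>Basis. (v \<bullet> i) *\<^sub>R i)"
    using tangent_proj_id[OF v] by (simp add: euclidean_representation)
  also have "\<dots> = (\<Sum>i\<in>Basis. (v \<bullet> i) *\<^sub>R tangent_proj p i)"
    by (simp add: linear_sum[OF tangent_proj_linear] linear_scale[OF tangent_proj_linear])
  finally have e: "v = (\<Sum>i\<in>Basis. (v \<bullet> i) *\<^sub>R tangent_proj p i)" .
  have 1: "g p v w = (\<Sum>i\<in>Basis. (v \<bullet> i) * g p (tangent_proj p i) w)" if "w \<in> tangent_space p" for w
    using metric_sum[OF p that finite_Basis, of "tangent_proj p" "\<lambda>i. v \<bullet> i"] tangent_proj_in[OF p] e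
    by simp
  have "g p v v = (\<Sum>i\<in>Basis. (v \<bullet> i) * g p v (tangent_proj p i))"
    using 1[OF v] metric_sym[OF p v] tangent_proj_in[OF p] by simp
  then show ?thesis
    using 1 tangent_proj_in[OF p] by simp
qed

text \<open>
  In the spanning fields the metric has continuous coefficients, and the coordinates of a
  tangent vector with respect to them are its Euclidean ones.
\<close>

lemma continuous_on_metric_norm:
  fixes P V :: "'a::topological_space \<Rightarrow> ambient"
  assumes "continuous_on K P" "continuous_on K V"
    and "\<And>x. x \<in> K \<Longrightarrow> P x \<in> S3xS1 \<and> V x \<in> tangent_space (P x)"
  shows "continuous_on K (\<lambda>x. metric_norm g (P x) (V x))"
proof -
  have c: "continuous_on K (\<lambda>x. g (P x) (tangent_proj (P x) j) (tangent_proj (P x) i))" for i j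
  proof -
    have "smooth_map_on S3xS1 (\<lambda>p. g p (tangent_proj p j) (tangent_proj p i))"
      using g smooth_vector_field_tangent_proj unfolding riemannian_metric_def by blast
    from smooth_map_on_imp_continuous_on[OF this] assms(1) show ?thesis
      by (rule continuous_on_compose2) (use assms(3) in auto)
  qed
  have "continuous_on K (\<lambda>x. sqrt (\<Sum>i\<in>Basis. (V x \<bullet> i) * (\<Sum>j\<in>Basis. (V x \<bullet> j) *
      g (P x) (tangent_proj (P x) j) (tangent_proj (P x) i))))"
    by (intro continuous_intros c assms)
  then show ?thesis
    by (rule continuous_on_eq) (simp add: metric_norm_def metric_eq_sum assms(3))
qed

text \<open>
  The unit tangent bundle is compact, and the norm is continuous and positive on it.
  Lyapunov exponents may therefore be computed with the Euclidean norm.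
\<close>

lemma metric_norm_comparable:
  obtains c C where "0 < c" "0 < C"
    "\<And>p v. p \<in> S3xS1 \<Longrightarrow> v \<in> tangent_space p \<Longrightarrow>
      c * norm v \<le> metric_norm g p v \<and> metric_norm g p v \<le> C * norm v"
proof -
  define K where "K = {x \<in> S3xS1 \<times> sphere 0 1. snd x \<in> tangent_space (fst x)}"
  have "closed {x::ambient \<times> ambient. snd x \<in> tangent_space (fst x)}"
    unfolding tangent_space_def mem_Collect_eq
    by (intro closed_Collect_conj closed_Collect_eq continuous_intros)
  moreover have "K = (S3xS1 \<times> sphere 0 1) \<inter> {x. snd x \<in> tangent_space (fst x)}"
    by (auto simp: K_def)
  ultimately have K: "compact K"
    by (simp add: compact_S3xS1 compact_Times compact_Int_closed)
  have cont: "continuous_on K (\<lambda>x. metric_norm g (fst x) (snd x))"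
    by (intro continuous_on_metric_norm continuous_intros) (auto simp: K_def)
  have pos: "0 < metric_norm g (fst x) (snd x)" if "x \<in> K" for x
    using that metric_norm_pos[of "fst x" "snd x"] by (force simp: K_def)
  obtain a b where ab: "0 < a" "0 < b"
    "\<And>x. x \<in> K \<Longrightarrow> a \<le> metric_norm g (fst x) (snd x) \<and> metric_norm g (fst x) (snd x) \<le> b"
  proof (cases "K = {}")
    case True
    then show ?thesis using that[of 1 1] by simp
  next
    case False
    obtain x where x: "x \<in> K" "\<And>y. y \<in> K \<Longrightarrow> metric_norm g (fst x) (snd x) \<le> metric_norm g (fst y) (snd y)"
      using continuous_attains_inf[OF K False cont] by blast
    obtain z where z: "z \<in> K" "\<And>y. y \<in> K \<Longrightarrow> metric_norm g (fst y) (snd y) \<le> metric_norm g (fst z) (snd z)"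
      using continuous_attains_sup[OF K False cont] by blast
    show ?thesis
      using that[OF pos[OF x(1)] pos[OF z(1)]] x(2) z(2) by simp
  qed
  show ?thesis
  proof
    fix p v assume p: "p \<in> S3xS1" and v: "v \<in> tangent_space p"
    show "a * norm v \<le> metric_norm g p v \<and> metric_norm g p v \<le> b * norm v"
    proof (cases "v = 0")
      case True
      then show ?thesis using metric_norm_scale[OF p v, of 0] by simp
    next
      case False
      define w where "w = inverse (norm v) *\<^sub>R v"
      have vw: "v = norm v *\<^sub>R w" and w: "w \<in> tangent_space p" "norm w = 1"
        using False v by (auto simp: w_def tangent_space_linear)
      have "metric_norm g p v = norm v * metric_norm g p w"
        using metric_norm_scale[OF p w(1), of "norm v"] vw by simp
      then show ?thesis
        using ab(3)[of "(p, w)"] p w False by (simp add: K_def mult.commute)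
    qed
  qed (rule ab)+
qed

end

section \<open>The hyperbolic flow on the sphere\<close>

definition pole :: "real ^ 4" where "pole = axis 1 1"

lemma pole_inner [simp]: "pole \<bullet> pole = 1" and norm_pole [simp]: "norm pole = 1"
  by (simp_all add: pole_def inner_axis_axis)

text \<open>
  The conformal action of Lorentz boosts on the celestial sphere: the flow of the gradient
  of the height function \<open>y \<bullet> pole\<close>. It fixes \<open>pole\<close> and
  \<open>- pole\<close>, contracts at the former and expands at the latter. The inverse of
  \<open>boost_factor\<close> is the conformal factor.
\<close>

definition boost_factor :: "real \<Rightarrow> real ^ 4 \<Rightarrow> real" where
  "boost_factor t y = cosh t + sinh t * (y \<bullet> pole)"

definition boost :: "real \<Rightarrow> real ^ 4 \<Rightarrow> real ^ 4" where
  "boost t y = inverse (boost_factor t y) *\<^sub>R (y + ((cosh t - 1) * (y \<bullet> pole) + sinh t) *\<^sub>R pole)"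

lemma boost_factor_bounds:
  assumes "norm y = 1"
  shows "exp (- \<bar>t\<bar>) \<le> boost_factor t y" "boost_factor t y \<le> exp \<bar>t\<bar>" "0 < boost_factor t y"
proof -
  define s where "s = y \<bullet> pole"
  have "\<bar>s\<bar> \<le> 1" using Cauchy_Schwarz_ineq2[of y pole] assms by (simp add: s_def)
  then have w: "0 \<le> (1 + s) / 2" "0 \<le> (1 - s) / 2" "(1 + s) / 2 + (1 - s) / 2 = 1"
    by (auto simp: field_simps)
  have e: "boost_factor t y = (1 + s) / 2 * exp t + (1 - s) / 2 * exp (- t)"
    by (simp add: boost_factor_def cosh_field_def sinh_field_def s_def field_simps)
  have m: "exp (- \<bar>t\<bar>) \<le> exp t" "exp (- \<bar>t\<bar>) \<le> exp (- t)" "exp t \<le> exp \<bar>t\<bar>" "exp (- t) \<le> exp \<bar>t\<bar>"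
    by auto
  have "(1 + s) / 2 * exp (- \<bar>t\<bar>) + (1 - s) / 2 * exp (- \<bar>t\<bar>) \<le> boost_factor t y"
    unfolding e by (intro add_mono mult_left_mono m w)
  then show lo: "exp (- \<bar>t\<bar>) \<le> boost_factor t y"
    using w(3) by (metis distrib_right mult_1)
  have "boost_factor t y \<le> (1 + s) / 2 * exp \<bar>t\<bar> + (1 - s) / 2 * exp \<bar>t\<bar>"
    unfolding e by (intro add_mono mult_left_mono m w)
  then show "boost_factor t y \<le> exp \<bar>t\<bar>"
    using w(3) by (metis distrib_right mult_1)
  show "0 < boost_factor t y" using lo exp_gt_zero[of "- \<bar>t\<bar>"] by linarith
qed

lemma boost_inner_pole:
  "boost t y \<bullet> pole = inverse (boost_factor t y) * (cosh t * (y \<bullet> pole) + sinh t)"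
  by (simp add: boost_def inner_add_left algebra_simps)

lemma norm_boost:
  assumes "norm y = 1" shows "norm (boost t y) = 1"
proof -
  define s d where "s = y \<bullet> pole" and "d = boost_factor t y"
  have d: "d > 0" using boost_factor_bounds[OF assms] by (simp add: d_def)
  have yy: "y \<bullet> y = 1" using assms by (simp add: dot_square_norm)
  define c where "c = (cosh t - 1) * s + sinh t"
  have "(y + c *\<^sub>R pole) \<bullet> (y + c *\<^sub>R pole) = 1 + 2 * c * s + c\<^sup>2"
    by (simp add: inner_add_left inner_add_right yy s_def inner_commute power2_eq_square)
  also have "\<dots> = d\<^sup>2 + (cosh t ^ 2 - sinh t ^ 2 - 1) * (s\<^sup>2 - 1)"
    by (simp add: c_def d_def boost_factor_def flip: s_def) (simp add: algebra_simps power2_eq_square)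
  also have "\<dots> = d\<^sup>2" using hyperbolic_pythagoras[of t] by simp
  finally have "norm (y + c *\<^sub>R pole) = d" using d by (simp add: norm_eq_sqrt_inner)
  then show ?thesis using d by (simp add: boost_def c_def s_def d_def)
qed

lemma boost_0 [simp]: "boost 0 y = y"
  by (simp add: boost_def boost_factor_def)

lemma boost_minus_pole: "boost t (- pole) = - pole"
proof -
  have "boost_factor t (- pole) > 0" by (rule boost_factor_bounds) simp
  moreover have "- pole + ((cosh t - 1) * (- pole \<bullet> pole) + sinh t) *\<^sub>R pole = boost_factor t (- pole) *\<^sub>R (- pole)"
    by (simp add: boost_factor_def algebra_simps)
  ultimately show ?thesis unfolding boost_def by simp
qed

lemma boost_factor_minus_pole: "boost_factor t (- pole) = exp (- t)"
  by (simp add: boost_factor_def cosh_minus_sinh)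

lemma boost_factor_boost:
  assumes "norm y = 1"
  shows "boost_factor t (boost r y) = boost_factor (t + r) y * inverse (boost_factor r y)"
proof -
  have d: "boost_factor r y > 0" using boost_factor_bounds[OF assms] by simp
  have "boost_factor t (boost r y) = inverse (boost_factor r y)
    * (cosh t * boost_factor r y + sinh t * (cosh r * (y \<bullet> pole) + sinh r))"
    using d unfolding boost_factor_def[of t] boost_inner_pole by (simp add: algebra_simps)
  also have "cosh t * boost_factor r y + sinh t * (cosh r * (y \<bullet> pole) + sinh r) = boost_factor (t + r) y"
    by (simp add: boost_factor_def cosh_add sinh_add algebra_simps)
  finally show ?thesis by (simp add: mult.commute)
qed

lemma boost_boost:
  assumes "norm y = 1"
  shows "boost t (boost r y) = boost (t + r) y"
proof -
  define s d where "s = y \<bullet> pole" and "d = boost_factor r y"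
  have d: "d > 0" using boost_factor_bounds[OF assms] by (simp add: d_def)
  have "boost t (boost r y) = inverse (boost_factor (t + r) y) *\<^sub>R (d *\<^sub>R
      (boost r y + ((cosh t - 1) * (boost r y \<bullet> pole) + sinh t) *\<^sub>R pole))"
    unfolding boost_def[of t] boost_factor_boost[OF assms] by (simp flip: d_def)
  also have "d *\<^sub>R (boost r y + ((cosh t - 1) * (boost r y \<bullet> pole) + sinh t) *\<^sub>R pole)
    = d *\<^sub>R boost r y + ((cosh t - 1) * (d * (boost r y \<bullet> pole)) + sinh t * d) *\<^sub>R pole"
    by (simp add: algebra_simps)
  also have "d *\<^sub>R boost r y = y + ((cosh r - 1) * s + sinh r) *\<^sub>R pole"
    using d by (simp add: boost_def d_def s_def)
  also have "d * (boost r y \<bullet> pole) = cosh r * s + sinh r"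
    using d by (simp add: boost_inner_pole d_def s_def)
  also have "y + ((cosh r - 1) * s + sinh r) *\<^sub>R pole
      + ((cosh t - 1) * (cosh r * s + sinh r) + sinh t * d) *\<^sub>R pole
    = y + ((cosh (t + r) - 1) * s + sinh (t + r)) *\<^sub>R pole"
    by (simp add: d_def boost_factor_def cosh_add sinh_add flip: s_def) (simp add: algebra_simps)
  finally show ?thesis by (simp add: boost_def s_def)
qed

text \<open>
  Up to the conformal factor, \<open>W\<close> is the image of \<open>\<eta>\<close> under
  the differential of the boost at \<open>y\<close>.
\<close>

lemma boost_differential_conformal:
  fixes \<eta> y t
  defines "W \<equiv> \<eta> + ((cosh t - 1) * (\<eta> \<bullet> pole)) *\<^sub>R pole - (sinh t * (\<eta> \<bullet> pole)) *\<^sub>R boost t y"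
  assumes y: "norm y = 1" and \<eta>: "\<eta> \<bullet> y = 0"
  shows "norm W = norm \<eta>" and "W \<bullet> boost t y = 0"
proof -
  define s d k H where "s = y \<bullet> pole" and "d = boost_factor t y" and "k = \<eta> \<bullet> pole" and "H = boost t y"
  have d: "d > 0" using boost_factor_bounds[OF y] by (simp add: d_def)
  have HH: "H \<bullet> H = 1" using norm_boost[OF y] by (simp add: dot_square_norm H_def)
  have dH: "d *\<^sub>R H = y + ((cosh t - 1) * s + sinh t) *\<^sub>R pole"
    using d by (simp add: boost_def d_def s_def H_def)
  have Hp: "d * (H \<bullet> pole) = cosh t * s + sinh t"
    using d by (simp add: boost_inner_pole d_def s_def H_def)
  have "d * (\<eta> \<bullet> H) = \<eta> \<bullet> (d *\<^sub>R H)" by simp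
  also have "\<dots> = ((cosh t - 1) * s + sinh t) * k"
    unfolding dH by (simp add: inner_add_right \<eta> k_def)
  finally have \<eta>H: "d * (\<eta> \<bullet> H) = ((cosh t - 1) * s + sinh t) * k" .
  have dd: "d = cosh t + sinh t * s" by (simp add: d_def boost_factor_def s_def)
  have ch: "cosh t ^ 2 = 1 + sinh t ^ 2" using hyperbolic_pythagoras[of t] by simp
  have "d * (\<eta> \<bullet> H + (cosh t - 1) * k * (H \<bullet> pole)) = d * (sinh t * k)"
    using \<eta>H Hp dd ch by algebra
  then have key: "\<eta> \<bullet> H + (cosh t - 1) * k * (H \<bullet> pole) = sinh t * k"
    using d by simp
  have W: "W = \<eta> + ((cosh t - 1) * k) *\<^sub>R pole - (sinh t * k) *\<^sub>R H"
    by (simp add: W_def k_def H_def)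
  show "W \<bullet> boost t y = 0"
    unfolding W using key by (simp add: inner_diff_left inner_add_left HH inner_commute[of pole H] flip: H_def)
  have "W \<bullet> W = \<eta> \<bullet> \<eta> + ((cosh t - 1) * k)\<^sup>2 + (sinh t * k)\<^sup>2 + 2 * (cosh t - 1) * k * k
     - 2 * sinh t * k * (\<eta> \<bullet> H + (cosh t - 1) * k * (H \<bullet> pole))"
    unfolding W k_def
    by (simp add: inner_diff_left inner_add_left inner_diff_right inner_add_right HH inner_commute power2_eq_square)
      (simp add: algebra_simps)
  also have "\<dots> = \<eta> \<bullet> \<eta>"
    unfolding key using ch by algebra
  finally show "norm W = norm \<eta>" by (simp add: norm_eq_sqrt_inner)
qed

section \<open>Rotations of the circle\<close>

definition quarter_turn :: "real ^ 2 \<Rightarrow> real ^ 2" where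
  "quarter_turn u = vector [- u $ 2, u $ 1]"

definition rot :: "real \<Rightarrow> real ^ 2 \<Rightarrow> real ^ 2" where
  "rot a u = cos a *\<^sub>R u + sin a *\<^sub>R quarter_turn u"

lemma rot_nth: "rot a u $ 1 = cos a * u $ 1 - sin a * u $ 2" "rot a u $ 2 = cos a * u $ 2 + sin a * u $ 1"
  by (simp_all add: rot_def quarter_turn_def)

lemma rot_rot: "rot a (rot b u) = rot (a + b) u"
  by (simp add: vec_eq_iff forall_2 rot_nth cos_add sin_add algebra_simps)

lemma rot_0 [simp]: "rot 0 u = u"
  by (simp add: rot_def)

lemma linear_rot: "linear (rot a)"
  by (rule linearI) (simp_all add: vec_eq_iff forall_2 rot_nth algebra_simps)

lemma linear_quarter_turn: "linear quarter_turn"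
  by (rule linearI) (simp_all add: vec_eq_iff forall_2 quarter_turn_def)

lemma inner_rot: "rot a u \<bullet> rot a v = u \<bullet> v"
proof -
  have "(cos a * x - sin a * y) * (cos a * x' - sin a * y') + (cos a * y + sin a * x) * (cos a * y' + sin a * x')
    = x * x' + y * y'" for x y x' y'
    using sin_cos_squared_add[of a] by algebra
  then show ?thesis by (simp add: inner_vec_def sum_2 rot_nth)
qed

lemma norm_rot [simp]: "norm (rot a u) = norm u"
  by (simp add: norm_eq_sqrt_inner inner_rot)

lemma inner_rot_adjoint: "l \<bullet> rot a u = rot (- a) l \<bullet> u"
  using inner_rot[of "- a" l "rot a u"] by (simp add: rot_rot)

lemma norm_rot_diff: "(norm (rot a u - u))\<^sup>2 = (2 - 2 * cos a) * (norm u)\<^sup>2"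
proof -
  have "(cos a * x - sin a * y - x)\<^sup>2 + (cos a * y + sin a * x - y)\<^sup>2 = (2 - 2 * cos a) * (x\<^sup>2 + y\<^sup>2)" for x y
    using sin_cos_squared_add[of a] by algebra
  then show ?thesis
    by (simp add: power2_norm_eq_inner) (simp add: inner_vec_def sum_2 rot_nth power2_eq_square)
qed

lemma rot_plus_2pi_int: "rot (a + 2 * pi * of_int k) u = rot a u"
proof -
  have "cos (a + 2 * pi * of_int k) = cos a" "sin (a + 2 * pi * of_int k) = sin a"
    using cos.plus_of_int[of a k] sin.plus_of_int[of a k] by (simp_all add: mult.commute)
  then show ?thesis by (simp add: rot_def)
qed

section \<open>Twisted boosts\<close>

text \<open>
  Skew products over the rotations of the circle, where the boosting time is a linear
  function of the point of the circle. Rotations preserve linearity, so these maps form a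
  group under composition, in which the vectors \<open>l\<close> add up after being rotated
  back.
\<close>

definition twist :: "real \<Rightarrow> real ^ 2 \<Rightarrow> ambient \<Rightarrow> ambient" where
  "twist \<theta> l p = (boost (l \<bullet> snd p) (fst p), rot \<theta> (snd p))"

lemma S3xS1_iff: "p \<in> S3xS1 \<longleftrightarrow> norm (fst p) = 1 \<and> norm (snd p) = 1"
  by (cases p) (simp add: S3xS1_def)

lemma twist_in_S3xS1: "p \<in> S3xS1 \<Longrightarrow> twist \<theta> l p \<in> S3xS1"
  by (simp add: S3xS1_iff twist_def norm_boost)

lemma twist_0: "twist 0 0 p = p"
  by (simp add: twist_def)

lemma twist_twist:
  assumes "p \<in> S3xS1"
  shows "twist \<theta>' l' (twist \<theta> l p) = twist (\<theta>' + \<theta>) (rot (- \<theta>) l' + l) p"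
  using assms by (simp add: twist_def S3xS1_iff boost_boost rot_rot inner_rot_adjoint inner_add_left)

lemma twist_inverse:
  assumes "p \<in> S3xS1"
  shows "twist (- \<theta>) (- rot \<theta> l) (twist \<theta> l p) = p" "twist \<theta> l (twist (- \<theta>) (- rot \<theta> l) p) = p"
  using assms linear_neg[OF linear_rot]
  by (simp_all add: twist_twist rot_rot twist_0)

lemma smooth_map_on_twist: "smooth_map_on S3xS1 (twist \<theta> l)"
proof -
  \<comment> \<open>The formula for the boost is singular at some points off the sphere, so the extension lives on \<open>U\<close> only.\<close>
  define T U where "T = (\<lambda>p::ambient. l \<bullet> snd p)" and "U = {p::ambient. boost_factor (T p) (fst p) \<noteq> 0}"
  have hyp: "sinh t = (1/2) *\<^sub>R (exp t + (- 1) *\<^sub>R exp ((- 1) *\<^sub>R t))"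
    "cosh t = (1/2) *\<^sub>R (exp t + exp ((- 1) *\<^sub>R t))" for t :: real
    by (simp_all add: sinh_def cosh_def)
  have eq: "twist \<theta> l = (\<lambda>p. inverse (cosh (T p) + (sinh (T p) *\<^sub>R (fst p \<bullet> pole))) *\<^sub>R
      ((fst p, 0) + ((cosh (T p) + - 1) *\<^sub>R (fst p \<bullet> pole) + sinh (T p)) *\<^sub>R (pole, 0)) + (0, rot \<theta> (snd p)))"
    by (auto simp: twist_def boost_def boost_factor_def T_def)
  have "continuous_on UNIV (\<lambda>p. boost_factor (T p) (fst p))"
    unfolding boost_factor_def T_def by (intro continuous_intros)
  then have U: "open U"
    unfolding U_def by (intro open_Collect_neq continuous_on_const)
  have Un0: "cosh (T p) + sinh (T p) *\<^sub>R (fst p \<bullet> pole) \<noteq> 0" if "p \<in> U" for p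
    using that by (simp add: U_def boost_factor_def)
  have T: "Ck_on k U T" for k
    unfolding T_def
    by (intro Ck_on_linear U bounded_linear_compose[OF bounded_linear_inner_right bounded_linear_snd])
  have ch: "Ck_on k U (\<lambda>p. cosh (T p))" and sh: "Ck_on k U (\<lambda>p. sinh (T p))" for k
    unfolding hyp by (intro Ck_on_scaleR Ck_on_add Ck_on_exp Ck_on_const U T)+
  have q: "Ck_on k U (\<lambda>p. fst p \<bullet> pole)" for k
    by (intro Ck_on_linear U bounded_linear_compose[OF bounded_linear_inner_left bounded_linear_fst])
  have "bounded_linear (rot \<theta>)" using linear_rot by (simp add: linear_linear)
  then have r: "Ck_on k U (\<lambda>p. (0::real^4, rot \<theta> (snd p)))" for k
    by (intro Ck_on_linear U bounded_linear_Pair bounded_linear_zero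
        bounded_linear_compose[OF _ bounded_linear_snd])
  have f: "Ck_on k U (\<lambda>p. (fst p, 0::real^2))" for k
    by (intro Ck_on_linear U bounded_linear_Pair bounded_linear_zero bounded_linear_fst)
  have "Ck_on k U (twist \<theta> l)" for k
    unfolding eq
    by (intro Ck_on_add Ck_on_scaleR Ck_on_inverse Ck_on_const U ch sh q r f Un0)
  then have "smooth_on_open U (twist \<theta> l)"
    using U by (simp add: smooth_on_open_def)
  moreover have "S3xS1 \<subseteq> U"
    using boost_factor_bounds(3) by (auto simp: U_def S3xS1_iff less_imp_neq[symmetric])
  ultimately show ?thesis unfolding smooth_map_on_def by blast
qed

lemma smooth_diffeo_twist: "smooth_diffeo S3xS1 (twist \<theta> l)"
proof -
  have bij: "bij_betw (twist \<theta> l) S3xS1 S3xS1"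
    by (rule bij_betw_byWitness[where f' = "twist (- \<theta>) (- rot \<theta> l)"])
      (auto simp: twist_inverse twist_in_S3xS1)
  have "inv_into S3xS1 (twist \<theta> l) p = twist (- \<theta>) (- rot \<theta> l) p" if "p \<in> S3xS1" for p
    using bij that twist_inverse(2)[OF that, of \<theta> l] twist_in_S3xS1[OF that]
    by (metis bij_betw_inv_into_left)
  then have "smooth_map_on S3xS1 (inv_into S3xS1 (twist \<theta> l))"
    using smooth_map_on_cong[OF _ smooth_map_on_twist] by simp
  with bij smooth_map_on_twist show ?thesis by (simp add: smooth_diffeo_def)
qed

text \<open>
  The last summand of the first component is the velocity of the boost flow, which comes
  from the variation of the boosting time.
\<close>

definition twist_deriv :: "real \<Rightarrow> real ^ 2 \<Rightarrow> ambient \<Rightarrow> ambient \<Rightarrow> ambient" where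
  "twist_deriv \<theta> l p v =
     (let t = l \<bullet> snd p; k = fst v \<bullet> pole; H = boost t (fst p) in
       (inverse (boost_factor t (fst p)) *\<^sub>R
           (fst v + ((cosh t - 1) * k) *\<^sub>R pole - (sinh t * k) *\<^sub>R H)
         + (l \<bullet> snd v) *\<^sub>R (pole - (H \<bullet> pole) *\<^sub>R H),
        rot \<theta> (snd v)))"

lemma has_derivative_twist:
  assumes p: "p \<in> S3xS1"
  shows "(twist \<theta> l has_derivative twist_deriv \<theta> l p) (at p within S3xS1)"
proof -
  define d where "d = boost_factor (l \<bullet> snd p) (fst p)"
  have d: "d > 0" using boost_factor_bounds p by (simp add: d_def S3xS1_iff)
  define t s where "t = l \<bullet> snd p" and "s = fst p \<bullet> pole"
  define N where "N = fst p + ((cosh t - 1) * s + sinh t) *\<^sub>R pole"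
  define H where "H = boost t (fst p)"
  have H: "H = inverse d *\<^sub>R N" by (simp add: H_def boost_def N_def s_def d_def t_def)
  define d' where "d' v = (sinh t + cosh t * s) * (l \<bullet> snd v) + sinh t * (fst v \<bullet> pole)" for v :: ambient
  define N' where "N' v = fst v + ((sinh t * s + cosh t) * (l \<bullet> snd v) + (cosh t - 1) * (fst v \<bullet> pole)) *\<^sub>R pole"
    for v :: ambient
  have ch: "((\<lambda>p. cosh (l \<bullet> snd p)) has_derivative (\<lambda>v. (l \<bullet> snd v) * sinh t)) (at p within S3xS1)"
    and sh: "((\<lambda>p. sinh (l \<bullet> snd p)) has_derivative (\<lambda>v. (l \<bullet> snd v) * cosh t)) (at p within S3xS1)"
    unfolding t_def
    by (rule DERIV_compose_FDERIV; auto intro!: derivative_eq_intros)+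
  have dd: "((\<lambda>p. boost_factor (l \<bullet> snd p) (fst p)) has_derivative d') (at p within S3xS1)"
    unfolding boost_factor_def d'_def t_def s_def
    by (auto intro!: derivative_eq_intros ch sh ext simp: algebra_simps t_def)
  have dN: "((\<lambda>p. fst p + ((cosh (l \<bullet> snd p) - 1) * (fst p \<bullet> pole) + sinh (l \<bullet> snd p)) *\<^sub>R pole)
      has_derivative N') (at p within S3xS1)"
    unfolding N'_def t_def s_def
    by (auto intro!: derivative_eq_intros ch sh ext simp: algebra_simps t_def)
  have di: "((\<lambda>p. inverse (boost_factor (l \<bullet> snd p) (fst p))) has_derivative (\<lambda>v. - (inverse d * d' v * inverse d)))
      (at p within S3xS1)"
    unfolding d_def by (rule Deriv.has_derivative_inverse[OF _ dd]) (use d in \<open>simp add: d_def\<close>)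
  have b: "((\<lambda>p. boost (l \<bullet> snd p) (fst p)) has_derivative
      (\<lambda>v. inverse d *\<^sub>R N' v + - (inverse d * d' v * inverse d) *\<^sub>R N)) (at p within S3xS1)"
    unfolding boost_def using has_derivative_scaleR[OF di dN]
    by (simp add: N_def d_def t_def s_def)
  have r: "((\<lambda>p. rot \<theta> (snd p)) has_derivative (\<lambda>v. rot \<theta> (snd v))) (at p within S3xS1)"
    using linear_rot
    by (intro bounded_linear.has_derivative[of "rot \<theta>"] has_derivative_snd has_derivative_ident)
      (simp add: linear_linear)
  have "inverse d *\<^sub>R N' v + - (inverse d * d' v * inverse d) *\<^sub>R N = fst (twist_deriv \<theta> l p v)" for v
  proof -
    define k m where "k = fst v \<bullet> pole" and "m = l \<bullet> snd v"
    have dt: "boost_factor t (fst p) = d" by (simp add: d_def t_def)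
    have ds: "d = cosh t + sinh t * s" by (simp add: d_def boost_factor_def t_def s_def)
    have Hp: "H \<bullet> pole = inverse d * (cosh t * s + sinh t)"
      by (simp add: H_def boost_inner_pole d_def s_def t_def)
    have 1: "inverse d *\<^sub>R N' v = inverse d *\<^sub>R (fst v + ((cosh t - 1) * k) *\<^sub>R pole) + m *\<^sub>R pole"
    proof -
      have "N' v = fst v + ((cosh t - 1) * k) *\<^sub>R pole + d *\<^sub>R (m *\<^sub>R pole)"
        unfolding N'_def ds by (simp add: k_def m_def algebra_simps)
      then show ?thesis using d by (simp add: scaleR_add_right)
    qed
    have 2: "(inverse d * d' v * inverse d) *\<^sub>R N = inverse d *\<^sub>R ((sinh t * k) *\<^sub>R H) + (m * (H \<bullet> pole)) *\<^sub>R H"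
      unfolding Hp d'_def unfolding H by (simp add: k_def m_def algebra_simps flip: scaleR_add_left)
    have "inverse d *\<^sub>R N' v + - (inverse d * d' v * inverse d) *\<^sub>R N =
      inverse d *\<^sub>R (fst v + ((cosh t - 1) * k) *\<^sub>R pole) + m *\<^sub>R pole
      - (inverse d *\<^sub>R ((sinh t * k) *\<^sub>R H) + (m * (H \<bullet> pole)) *\<^sub>R H)"
      unfolding 1 2[symmetric] by simp
    also have "\<dots> = fst (twist_deriv \<theta> l p v)"
      unfolding twist_deriv_def Let_def fst_conv t_def[symmetric] H_def[symmetric]
        k_def[symmetric] m_def[symmetric] dt
      by (simp add: algebra_simps)
    finally show ?thesis .
  qed
  then have "(\<lambda>v. (inverse d *\<^sub>R N' v + - (inverse d * d' v * inverse d) *\<^sub>R N, rot \<theta> (snd v))) = twist_deriv \<theta> l p"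
    by (auto simp: twist_deriv_def Let_def)
  then show ?thesis
    using has_derivative_Pair[OF b r] by (simp add: twist_def[abs_def])
qed

lemma tangent_map_eq_twist_deriv:
  assumes "\<And>q. q \<in> S3xS1 \<Longrightarrow> f q = twist \<theta> l q" "p \<in> S3xS1" "v \<in> tangent_space p"
  shows "tangent_map f p v = twist_deriv \<theta> l p v"
proof (rule tangent_map_unique[OF assms(2,3)])
  show "(f has_derivative twist_deriv \<theta> l p) (at p within S3xS1)"
    by (rule has_derivative_transform[OF assms(2) assms(1) has_derivative_twist[OF assms(2)]])
qed

lemma twist_deriv_in_tangent_space:
  assumes p: "p \<in> S3xS1" and v: "v \<in> tangent_space p"
  shows "twist_deriv \<theta> l p v \<in> tangent_space (twist \<theta> l p)"
proof -
  define t H where "t = l \<bullet> snd p" and "H = boost t (fst p)"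
  have y: "norm (fst p) = 1" and \<eta>: "fst v \<bullet> fst p = 0" and w: "snd v \<bullet> snd p = 0"
    using p v by (auto simp: S3xS1_iff tangent_space_def)
  have "H \<bullet> H = 1" using norm_boost[OF y] by (simp add: H_def dot_square_norm)
  then have "(pole - (H \<bullet> pole) *\<^sub>R H) \<bullet> H = 0"
    by (simp add: inner_diff_left inner_commute[of pole H])
  then show ?thesis
    using boost_differential_conformal(2)[OF y \<eta>, of t] w
    unfolding tangent_space_def twist_deriv_def twist_def Let_def
    by (simp add: inner_add_left inner_rot flip: t_def H_def)
qed

lemma continuous_on_twist: "continuous_on S3xS1 (twist \<theta> l)"
  by (intro smooth_map_on_imp_continuous_on smooth_map_on_twist)

lemma continuous_on_twist_deriv:
  assumes "continuous_on S3xS1 V"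
  shows "continuous_on S3xS1 (\<lambda>p. twist_deriv \<theta> l p (V p))"
proof -
  have n0: "boost_factor (l \<bullet> snd p) (fst p) \<noteq> 0" if "p \<in> S3xS1" for p
    using boost_factor_bounds(3)[of "fst p" "l \<bullet> snd p"] that by (simp add: S3xS1_iff)
  have H: "continuous_on S3xS1 (\<lambda>p. boost (l \<bullet> snd p) (fst p))"
    using continuous_on_fst[OF continuous_on_twist[of \<theta> l]] by (simp add: twist_def)
  have "continuous_on S3xS1 (\<lambda>p. boost_factor (l \<bullet> snd p) (fst p))"
    unfolding boost_factor_def by (intro continuous_intros)
  then have i: "continuous_on S3xS1 (\<lambda>p. inverse (boost_factor (l \<bullet> snd p) (fst p)))"
    using n0 by (intro continuous_on_inverse) auto
  show ?thesis
    unfolding twist_deriv_def Let_def rot_def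
    by (intro continuous_intros i H assms linear_continuous_on_compose[OF _ linear_quarter_turn])
qed

text \<open>
  Quantitative bounds in terms of \<open>norm l\<close> alone: uniform control of
  \<open>l\<close> along an orbit forces zero exponents.
\<close>

context
  fixes p v :: ambient and l :: "real ^ 2" and \<theta> :: real
  assumes p: "p \<in> S3xS1" and v: "v \<in> tangent_space p"
begin

text \<open>
  The differential is block triangular, with a conformal block on the sphere, a rotation on
  the circle and a shear of size at most \<open>norm l\<close> along the boost flow.
\<close>

lemma twist_deriv_split:
  obtains W Z where "twist_deriv \<theta> l p v = (inverse (boost_factor (l \<bullet> snd p) (fst p)) *\<^sub>R W
      + (l \<bullet> snd v) *\<^sub>R Z, rot \<theta> (snd v))"
    "norm W = norm (fst v)" "norm Z \<le> 1" "fst p = - pole \<Longrightarrow> Z = 0"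
proof -
  define t H where "t = l \<bullet> snd p" and "H = boost t (fst p)"
  have y: "norm (fst p) = 1" and \<eta>: "fst v \<bullet> fst p = 0"
    using p v by (auto simp: S3xS1_iff tangent_space_def)
  have HH: "H \<bullet> H = 1" using norm_boost[OF y] by (simp add: H_def dot_square_norm)
  have "(norm (pole - (H \<bullet> pole) *\<^sub>R H))\<^sup>2 = 1 - (H \<bullet> pole)\<^sup>2"
    unfolding power2_norm_eq_inner
    by (simp add: inner_diff_left inner_diff_right HH inner_commute[of pole H] power2_eq_square)
  then have "(norm (pole - (H \<bullet> pole) *\<^sub>R H))\<^sup>2 \<le> 1\<^sup>2" by simp
  then have Z: "norm (pole - (H \<bullet> pole) *\<^sub>R H) \<le> 1"
    by (rule power2_le_imp_le) simp
  have Z0: "pole - (H \<bullet> pole) *\<^sub>R H = 0" if "fst p = - pole"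
    using that by (simp add: H_def boost_minus_pole)
  show ?thesis
    by (rule that[OF _ boost_differential_conformal(1)[OF y \<eta>, of t] Z Z0])
      (simp_all add: twist_deriv_def Let_def t_def H_def)
qed

lemma norm_twist_deriv_le: "norm (twist_deriv \<theta> l p v) \<le> (exp (norm l) + norm l + 1) * norm v"
  and norm_le_twist_deriv: "norm v \<le> (exp (norm l) * (1 + norm l) + 1) * norm (twist_deriv \<theta> l p v)"
proof -
  define t d where "t = l \<bullet> snd p" and "d = boost_factor t (fst p)"
  have y: "norm (fst p) = 1" "norm (snd p) = 1" using p by (auto simp: S3xS1_iff)
  have t: "\<bar>t\<bar> \<le> norm l" using Cauchy_Schwarz_ineq2[of l "snd p"] y by (simp add: t_def)
  have d: "d > 0" "exp (- norm l) \<le> d" "d \<le> exp (norm l)"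
    using boost_factor_bounds[OF y(1), of t] t by (auto simp: d_def intro: order_trans[rotated] order_trans)
  have di: "inverse d \<le> exp (norm l)"
    using le_imp_inverse_le[OF d(2)] by (simp add: exp_minus)
  obtain W Z where eq: "twist_deriv \<theta> l p v = (inverse d *\<^sub>R W + (l \<bullet> snd v) *\<^sub>R Z, rot \<theta> (snd v))"
    and WZ: "norm W = norm (fst v)" "norm Z \<le> 1"
    by (rule twist_deriv_split) (auto simp: t_def d_def)
  define D where "D = norm (twist_deriv \<theta> l p v)"
  have n: "norm (fst v) \<le> norm v" "norm (snd v) \<le> norm v" "norm v \<le> norm (fst v) + norm (snd v)"
    using norm_Pair_le[of "fst v" "snd v"] norm_fst_le[of "fst v" "snd v"] norm_snd_le[of "snd v" "fst v"]
    by simp_all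
  have lv: "norm ((l \<bullet> snd v) *\<^sub>R Z) \<le> norm l * norm (snd v)"
    using mult_mono[OF Cauchy_Schwarz_ineq2[of l "snd v"] WZ(2)] by simp
  have iW: "norm (inverse d *\<^sub>R W) = inverse d * norm (fst v)"
    using d by (simp add: WZ)
  have "D \<le> norm (inverse d *\<^sub>R W + (l \<bullet> snd v) *\<^sub>R Z) + norm (snd v)"
    unfolding D_def eq using norm_Pair_le[of _ "rot \<theta> (snd v)"] by simp
  also have "\<dots> \<le> inverse d * norm (fst v) + norm l * norm (snd v) + norm (snd v)"
    using norm_triangle_ineq[of "inverse d *\<^sub>R W" "(l \<bullet> snd v) *\<^sub>R Z"] lv iW by linarith
  also have "\<dots> \<le> exp (norm l) * norm v + norm l * norm v + norm v"
    using n di by (intro add_mono mult_mono) auto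
  finally show "norm (twist_deriv \<theta> l p v) \<le> (exp (norm l) + norm l + 1) * norm v"
    by (simp add: D_def algebra_simps)
  have sD: "norm (snd v) \<le> D"
    using norm_snd_le[of "rot \<theta> (snd v)"] unfolding D_def eq by simp
  have "inverse d * norm (fst v) \<le> norm (inverse d *\<^sub>R W + (l \<bullet> snd v) *\<^sub>R Z) + norm ((l \<bullet> snd v) *\<^sub>R Z)"
    using norm_triangle_ineq4[of "inverse d *\<^sub>R W + (l \<bullet> snd v) *\<^sub>R Z" "(l \<bullet> snd v) *\<^sub>R Z"] iW by simp
  also have "\<dots> \<le> D + norm l * norm (snd v)"
    unfolding D_def eq by (intro add_mono lv norm_fst_le)
  also have "\<dots> \<le> D + norm l * D"
    using sD by (simp add: mult_left_mono)
  finally have "norm (fst v) \<le> d * (D * (1 + norm l))"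
    using d by (simp add: field_simps)
  also have "\<dots> \<le> exp (norm l) * (D * (1 + norm l))"
    using d by (intro mult_right_mono) (auto simp: D_def)
  finally show "norm v \<le> (exp (norm l) * (1 + norm l) + 1) * norm (twist_deriv \<theta> l p v)"
    using n sD by (simp add: D_def[symmetric] algebra_simps)
qed

text \<open>
  At the fixed point \<open>- pole\<close> the velocity of the boost flow vanishes, and the
  differential becomes block diagonal.
\<close>

lemma norm_twist_deriv_at_minus_pole:
  assumes "fst p = - pole"
  shows "(norm (twist_deriv \<theta> l p v))\<^sup>2 = (exp (l \<bullet> snd p) * norm (fst v))\<^sup>2 + (norm (snd v))\<^sup>2"
proof -
  obtain W Z where "twist_deriv \<theta> l p v = (inverse (boost_factor (l \<bullet> snd p) (fst p)) *\<^sub>R W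
      + (l \<bullet> snd v) *\<^sub>R Z, rot \<theta> (snd v))" "norm W = norm (fst v)" "Z = 0"
    by (rule twist_deriv_split) (use assms in auto)
  then show ?thesis
    by (simp add: norm_Pair assms boost_factor_minus_pole exp_minus)
qed

end

section \<open>The norm of the tangent map of a twist\<close>

lemma linear_twist_deriv:
  assumes "p \<in> S3xS1" shows "linear (twist_deriv \<theta> l p)"
  using has_derivative_linear[OF has_derivative_twist[OF assms]] .

lemma tangent_map_norm_twist:
  assumes "\<And>q. q \<in> S3xS1 \<Longrightarrow> f q = twist \<theta> l q" "p \<in> S3xS1"
  shows "tangent_map_norm g f p = tangent_map_norm g (twist \<theta> l) p"
  unfolding tangent_map_norm_def
  using assms by (intro SUP_cong) (simp_all add: tangent_map_eq_twist_deriv[of _ \<theta> l])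

definition cylinder :: "nat \<Rightarrow> (int \<Rightarrow> nat) \<Rightarrow> (int \<Rightarrow> nat) set" where
  "cylinder n x = {y. \<forall>j<n. y (int j) = x (int j)}"

lemma open_cylinder: "open (cylinder n x)"
proof -
  have "open {y :: int \<Rightarrow> nat. y i = k}" for i k
    using open_vimage[OF Topological_Spaces.open_discrete[of "{k}"] continuous_on_product_coordinates[of i]]
    by (simp add: vimage_def)
  then show ?thesis
    unfolding cylinder_def
    by (induction n) (auto simp: All_less_Suc intro: open_Collect_conj)
qed

context
  fixes g assumes g: "riemannian_metric g"
begin

text \<open>
  The second part expresses the supremum without normalised vectors. It still refers to the
  bound \<open>K\<close>, since the supremum is meaningful only for a bounded set.
\<close>

lemma tangent_map_norm_bounds:
  assumes p: "p \<in> S3xS1" and K: "0 \<le> K"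
    and le: "\<And>v. v \<in> tangent_space p \<Longrightarrow> metric_norm g (twist \<theta> l p) (twist_deriv \<theta> l p v) \<le> K * metric_norm g p v"
  shows "tangent_map_norm g (twist \<theta> l) p \<le> K"
    and "a < tangent_map_norm g (twist \<theta> l) p \<longleftrightarrow> (\<exists>v\<in>tangent_space p - {0}.
       a * metric_norm g p v < metric_norm g (twist \<theta> l p) (twist_deriv \<theta> l p v))"
proof -
  define V where "V = {v \<in> tangent_space p. metric_norm g p v = 1}"
  define G where "G v = metric_norm g (twist \<theta> l p) (twist_deriv \<theta> l p v)" for v
  have N: "tangent_map_norm g (twist \<theta> l) p = (SUP v\<in>V. G v)"
    unfolding tangent_map_norm_def V_def G_def using p
    by (intro SUP_cong refl) (simp add: tangent_map_eq_twist_deriv[of _ \<theta> l])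
  have bd: "G v \<le> K" if "v \<in> V" for v
    using le[of v] that by (simp add: V_def G_def)
  then have bdd: "bdd_above (G ` V)" by (auto intro!: bdd_aboveI2)
  have pos: "0 < metric_norm g p v" if "v \<in> tangent_space p - {0}" for v
    using metric_norm_pos[OF g p] that by auto
  have scale: "G (c *\<^sub>R v) = \<bar>c\<bar> * G v" if "v \<in> tangent_space p" for c v
    unfolding G_def linear_scale[OF linear_twist_deriv[OF p]]
    by (rule metric_norm_scale[OF g twist_in_S3xS1[OF p] twist_deriv_in_tangent_space[OF p that]])
  have unit: "inverse (metric_norm g p v) *\<^sub>R v \<in> V" if "v \<in> tangent_space p - {0}" for v
    using that pos[OF that]
    by (auto simp: V_def metric_norm_scale[OF g p] tangent_space_linear)
  obtain u :: ambient where u: "u \<in> tangent_space p - {0}"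
  proof -
    obtain w :: "real ^ 4" where "w \<noteq> 0" "orthogonal (fst p) w"
      by (rule orthogonal_to_vector_exists[of "fst p"]) simp
    then show ?thesis using that[of "(w, 0)"]
      by (simp add: tangent_space_def zero_prod_def orthogonal_def inner_commute)
  qed
  have ne: "V \<noteq> {}" using unit[OF u] by blast
  show "tangent_map_norm g (twist \<theta> l) p \<le> K"
    unfolding N by (rule cSUP_least[OF ne bd])
  show "a < tangent_map_norm g (twist \<theta> l) p \<longleftrightarrow> (\<exists>v\<in>tangent_space p - {0}.
       a * metric_norm g p v < metric_norm g (twist \<theta> l p) (twist_deriv \<theta> l p v))"
    unfolding N less_cSUP_iff[OF ne bdd] G_def[symmetric]
  proof
    assume "\<exists>v\<in>V. a < G v"
    then obtain v where v: "v \<in> V" "a < G v" by blast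
    then have "v \<noteq> 0" using metric_norm_scale[OF g p, of 0 0] by (auto simp: V_def tangent_space_linear)
    with v show "\<exists>v\<in>tangent_space p - {0}. a * metric_norm g p v < G v"
      by (auto simp: V_def intro!: bexI[of _ v])
  next
    assume "\<exists>v\<in>tangent_space p - {0}. a * metric_norm g p v < G v"
    then obtain v where v: "v \<in> tangent_space p - {0}" "a * metric_norm g p v < G v" by blast
    have "a < G (inverse (metric_norm g p v) *\<^sub>R v)"
      using v pos[OF v(1)] by (simp add: scale field_simps)
    then show "\<exists>v\<in>V. a < G v" using unit[OF v(1)] by blast
  qed
qed

lemma twist_deriv_metric_bounded:
  obtains K where "0 < K"
    "\<And>p v. p \<in> S3xS1 \<Longrightarrow> v \<in> tangent_space p \<Longrightarrow> 
      metric_norm g (twist \<theta> l p) (twist_deriv \<theta> l p v) \<le> K * metric_norm g p v"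
proof -
  obtain c C where cC: "0 < c" "0 < C"
    "\<And>p v. p \<in> S3xS1 \<Longrightarrow> v \<in> tangent_space p \<Longrightarrow>
      c * norm v \<le> metric_norm g p v \<and> metric_norm g p v \<le> C * norm v"
    using metric_norm_comparable[OF g] by blast
  define E where "E = exp (norm l) + norm l + 1"
  have E: "E > 0" by (simp add: E_def add_pos_nonneg)
  show ?thesis
  proof
    show "0 < C * E / c" using cC E by simp
    fix p v assume p: "p \<in> S3xS1" and v: "v \<in> tangent_space p"
    have "metric_norm g (twist \<theta> l p) (twist_deriv \<theta> l p v) \<le> C * norm (twist_deriv \<theta> l p v)"
      using cC(3)[OF twist_in_S3xS1[OF p] twist_deriv_in_tangent_space[OF p v]] by blast
    also have "\<dots> \<le> C * (E * norm v)"
      using norm_twist_deriv_le[OF p v, of \<theta> l] cC by (simp add: E_def)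
    also have "\<dots> = C * E / c * (c * norm v)" using cC by simp
    also have "\<dots> \<le> C * E / c * metric_norm g p v"
      using cC(3)[OF p v] cC(1,2) E by (intro mult_left_mono) auto
    finally show "metric_norm g (twist \<theta> l p) (twist_deriv \<theta> l p v) \<le> C * E / c * metric_norm g p v" .
  qed
qed

text \<open>
  Lower semicontinuity of the operator norm, as a supremum of continuous functions; the
  projections of a fixed vector provide these functions although the tangent space varies.
  It is what makes the integrand of the top exponent measurable.
\<close>

lemma open_tangent_map_norm_greater:
  obtains T where "open T" "{p \<in> S3xS1. a < tangent_map_norm g (twist \<theta> l) p} = T \<inter> S3xS1"
proof -
  obtain K where K: "0 < K" "\<And>p v. p \<in> S3xS1 \<Longrightarrow> v \<in> tangent_space p \<Longrightarrow> 
      metric_norm g (twist \<theta> l p) (twist_deriv \<theta> l p v) \<le> K * metric_norm g p v"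
    using twist_deriv_metric_bounded by blast
  define h where "h w p = metric_norm g (twist \<theta> l p) (twist_deriv \<theta> l p (tangent_proj p w))
     - a * metric_norm g p (tangent_proj p w)" for w p
  have proj: "continuous_on S3xS1 (\<lambda>p. tangent_proj p w)" for w
    unfolding tangent_proj_def by (intro continuous_intros)
  have h: "continuous_on S3xS1 (h w)" for w
    unfolding h_def
    by (intro continuous_intros continuous_on_metric_norm[OF g] continuous_on_twist
        continuous_on_twist_deriv proj)
      (auto simp: tangent_proj_in twist_in_S3xS1 twist_deriv_in_tangent_space)
  have eq: "{p \<in> S3xS1. a < tangent_map_norm g (twist \<theta> l) p} =
    (\<Union>w. (S3xS1 \<inter> h w -` {0<..}) \<inter> (S3xS1 \<inter> (\<lambda>p. tangent_proj p w) -` (- {0})))"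
    (is "?L = ?R")
  proof (rule set_eqI)
    fix p
    show "p \<in> ?L \<longleftrightarrow> p \<in> ?R"
    proof (cases "p \<in> S3xS1")
      case p: True
      have "(\<exists>v\<in>tangent_space p - {0}. a * metric_norm g p v < metric_norm g (twist \<theta> l p) (twist_deriv \<theta> l p v))
        \<longleftrightarrow> (\<exists>w. tangent_proj p w \<noteq> 0 \<and> 0 < h w p)"
        unfolding h_def using tangent_proj_in[OF p] tangent_proj_id[of _ p]
        by (metis Diff_iff diff_gt_0_iff_gt empty_iff insert_iff)
      then show ?thesis
        using p tangent_map_norm_bounds(2)[OF p less_imp_le[OF K(1)] K(2)[OF p], of a]
        by auto
    qed auto
  qed
  have "openin (top_of_set S3xS1) ?R"
    by (intro openin_Union ballI) (auto intro!: openin_Int continuous_openin_preimage_gen h proj)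
  then show ?thesis
    using that eq unfolding openin_open by (metis Int_commute)
qed

text \<open>
  With respect to the Euclidean metric the norm would be exactly the exponential of the
  boosting time; the metric contributes a bounded error.
\<close>

lemma tangent_map_norm_at_minus_pole:
  obtains B where "\<And>\<theta> l p. p \<in> S3xS1 \<Longrightarrow> fst p = - pole \<Longrightarrow> 0 \<le> l \<bullet> snd p \<Longrightarrow>
    \<bar>ln (tangent_map_norm g (twist \<theta> l) p) - l \<bullet> snd p\<bar> \<le> B"
proof -
  obtain c C where cC: "0 < c" "0 < C"
    "\<And>p v. p \<in> S3xS1 \<Longrightarrow> v \<in> tangent_space p \<Longrightarrow>
      c * norm v \<le> metric_norm g p v \<and> metric_norm g p v \<le> C * norm v"
    using metric_norm_comparable[OF g] by blast
  show ?thesis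
  proof
    fix \<theta> l p assume p: "p \<in> S3xS1" and y: "fst p = - pole" and t: "0 \<le> l \<bullet> snd p"
    define N E where "N = tangent_map_norm g (twist \<theta> l) p" and "E = exp (l \<bullet> snd p)"
    have E: "1 \<le> E" using t by (simp add: E_def)
    have cmp: "c * norm (twist_deriv \<theta> l p v) \<le> metric_norm g (twist \<theta> l p) (twist_deriv \<theta> l p v)"
      "metric_norm g (twist \<theta> l p) (twist_deriv \<theta> l p v) \<le> C * norm (twist_deriv \<theta> l p v)"
      if "v \<in> tangent_space p" for v
      using cC(3)[OF twist_in_S3xS1[OF p] twist_deriv_in_tangent_space[OF p that]] by auto
    have up: "metric_norm g (twist \<theta> l p) (twist_deriv \<theta> l p v) \<le> (C / c * E) * metric_norm g p v"
      if v: "v \<in> tangent_space p" for v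
    proof -
      have "(norm (twist_deriv \<theta> l p v))\<^sup>2 = (E * norm (fst v))\<^sup>2 + (norm (snd v))\<^sup>2"
        using norm_twist_deriv_at_minus_pole[OF p v y] by (simp add: E_def)
      also have "\<dots> \<le> (E * norm (fst v))\<^sup>2 + (E * norm (snd v))\<^sup>2"
        using E by (intro add_left_mono power_mono mult_right_mono[of 1 E, simplified]) auto
      also have "\<dots> = (E * norm v)\<^sup>2"
        using norm_Pair[of "fst v" "snd v"] by (simp add: power_mult_distrib distrib_left)
      finally have "norm (twist_deriv \<theta> l p v) \<le> E * norm v"
        by (rule power2_le_imp_le) (use E in simp)
      then have "C * norm (twist_deriv \<theta> l p v) \<le> C * (E * norm v)"
        using cC by simp
      also have "\<dots> = C / c * E * (c * norm v)" using cC by simp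
      also have "\<dots> \<le> C / c * E * metric_norm g p v"
        using cC(3)[OF p v] cC E by (intro mult_left_mono) auto
      finally show ?thesis using cmp(2)[OF v] by linarith
    qed
    have CE: "0 \<le> C / c * E" using cC E by simp
    have "N \<le> C / c * E"
      unfolding N_def using tangent_map_norm_bounds(1)[OF p CE up] .
    moreover have "c / C * E \<le> N"
    proof (rule dense_le)
      fix a assume a: "a < c / C * E"
      define v :: ambient where "v = (axis 2 1, 0)"
      have v: "v \<in> tangent_space p" "norm v = 1" "fst v = axis 2 1" "snd v = 0"
        by (simp_all add: v_def tangent_space_def y pole_def inner_axis_axis norm_Pair)
      have "(norm (twist_deriv \<theta> l p v))\<^sup>2 = E\<^sup>2"
        using norm_twist_deriv_at_minus_pole[OF p v(1) y] v by (simp add: E_def)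
      then have D: "norm (twist_deriv \<theta> l p v) = E" using E by simp
      have G: "0 < metric_norm g p v" "metric_norm g p v \<le> C"
        using cC(3)[OF p v(1)] v cC by auto
      have "a * metric_norm g p v < c / C * E * metric_norm g p v"
        using a G(1) by (rule mult_strict_right_mono)
      also have "\<dots> \<le> c / C * E * C"
        using G E cC by (intro mult_left_mono) auto
      also have "\<dots> \<le> metric_norm g (twist \<theta> l p) (twist_deriv \<theta> l p v)"
        using cmp(1)[OF v(1)] D cC by simp
      finally show "a \<le> N"
        unfolding N_def using tangent_map_norm_bounds(2)[OF p CE up, of a] v
        by (intro less_imp_le) (auto intro!: bexI[of _ v])
    qed
    ultimately have N: "c / C * E \<le> N" "N \<le> C / c * E" by auto
    have N0: "0 < c / C * E" using cC E by simp
    have "ln (c / C * E) \<le> ln N" "ln N \<le> ln (C / c * E)"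
      using N N0 by (auto intro!: ln_mono)
    moreover have "ln (c / C * E) = ln (c / C) + l \<bullet> snd p" "ln (C / c * E) = ln (C / c) + l \<bullet> snd p"
      using cC E by (subst ln_mult; simp add: E_def)+
    moreover have "ln (c / C) = - ln (C / c)" using cC by (simp add: ln_div)
    ultimately show "\<bar>ln (tangent_map_norm g (twist \<theta> l) p) - l \<bullet> snd p\<bar> \<le> ln (C / c)"
      by (simp add: N_def)
  qed
qed

end

section \<open>The cocycle and its periodic orbits\<close>

text \<open>
  Rotation numbers of the two symbols are \<open>base_rate\<close> and
  \<open>4 * base_rate\<close>. Any irrational number strictly between \<open>3/16\<close>
  and \<open>1/4\<close> would serve: irrationality keeps all products of these rotations
  nontrivial, and the bounds say that the first rotates forward by less than a quarter turn
  and, up to a full turn, the second rotates backward by less than a quarter turn.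
\<close>

definition base_rate :: real where "base_rate = sqrt 2 / 7"

lemma sqrt_2_irrational: "sqrt 2 \<notin> \<rat>"
proof
  assume "sqrt 2 \<in> \<rat>"
  then obtain m n :: nat where n: "n \<noteq> 0" and mn: "\<bar>sqrt 2\<bar> = real m / real n" and co: "coprime m n"
    by (rule Rats_abs_nat_div_natE)
  then have "real m = sqrt 2 * real n" by (simp add: field_simps)
  then have "(real m)\<^sup>2 = 2 * (real n)\<^sup>2" by (simp add: power_mult_distrib)
  then have eq: "m\<^sup>2 = 2 * n\<^sup>2" by (metis of_nat_eq_iff of_nat_mult of_nat_numeral of_nat_power)
  then have "even m" by (metis dvd_triv_left even_power)
  then obtain k where "m = 2 * k" by blast
  with eq have "n\<^sup>2 = 2 * k\<^sup>2" by (simp add: power_mult_distrib)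
  then have "even n" by (metis dvd_triv_left even_power)
  with \<open>even m\<close> co show False by (auto dest: coprime_common_divisor)
qed

lemma base_rate_irrational: "base_rate \<notin> \<rat>"
proof
  assume "base_rate \<in> \<rat>"
  then have "base_rate * 7 \<in> \<rat>" by (rule Rats_mult) simp
  then show False using sqrt_2_irrational by (simp add: base_rate_def)
qed

lemma base_rate_bounds: "3/16 < base_rate" "base_rate < 1/4"
proof -
  have "21/16 < sqrt 2" by (rule real_less_rsqrt) (simp add: power2_eq_square)
  moreover have "sqrt 2 < 7/4" by (rule real_less_lsqrt) (simp_all add: power2_eq_square)
  ultimately show "3/16 < base_rate" "base_rate < 1/4" by (simp_all add: base_rate_def)
qed

definition east :: "real ^ 2" where "east = axis 1 1"

lemma norm_east [simp]: "norm east = 1" by (simp add: east_def)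

definition winding :: "nat \<Rightarrow> nat" where "winding s = (if s = 0 then 1 else 4)"

definition twist_cocycle :: cocycle where
  "twist_cocycle x = twist (2 * pi * base_rate * winding (x 0)) east"

text \<open>
  The parameters of the iterates as twists. By \<open>drift_inner\<close> below,
  \<open>drift\<close> is the vector that represents the Birkhoff sums of the first
  coordinate along the orbit in the circle.
\<close>

definition phase :: "nat \<Rightarrow> (int \<Rightarrow> nat) \<Rightarrow> real" where
  "phase n x = 2 * pi * base_rate * (\<Sum>j<n. winding (x (int j)))"

definition drift :: "nat \<Rightarrow> (int \<Rightarrow> nat) \<Rightarrow> real ^ 2" where
  "drift n x = (\<Sum>j<n. rot (- phase j x) east)"

lemma left_shift_funpow: "(left_shift ^^ n) x i = x (i + int n)"
  by (induction n arbitrary: i) (simp_all add: left_shift_def algebra_simps)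

lemma cocycle_iterate_eq_twist:
  assumes "p \<in> S3xS1"
  shows "cocycle_iterate twist_cocycle n x p = twist (phase n x) (drift n x) p"
proof (induction n)
  case 0
  then show ?case by (simp add: phase_def drift_def twist_0)
next
  case (Suc n)
  then show ?case
    by (simp add: twist_cocycle_def left_shift_funpow twist_twist[OF assms] phase_def drift_def
        distrib_left add.commute)
qed

lemma locally_constant_twist_cocycle: "locally_constant_cocycle S twist_cocycle"
proof -
  have "twist_cocycle y = twist_cocycle x" if "y \<in> cylinder 1 x" for x y
    using that by (simp add: cylinder_def twist_cocycle_def)
  moreover have "x \<in> cylinder 1 x" for x by (simp add: cylinder_def)
  ultimately show ?thesis
    unfolding locally_constant_cocycle_def
    using smooth_diffeo_twist open_cylinder by (metis IntD1 twist_cocycle_def)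
qed

lemma phase_cong: "y \<in> cylinder n x \<Longrightarrow> j \<le> n \<Longrightarrow> phase j y = phase j x"
  by (simp add: cylinder_def phase_def)

lemma drift_cong: "y \<in> cylinder n x \<Longrightarrow> drift n y = drift n x"
  by (simp add: drift_def phase_cong)

lemma drift_inner: "drift n x \<bullet> u = (\<Sum>j<n. east \<bullet> rot (phase j x) u)"
  by (simp add: drift_def inner_sum_left inner_rot_adjoint)

text \<open>
  No nonempty word acts on the circle as the identity, since the angle is a positive integer
  multiple of an irrational fraction of a full turn.
\<close>

lemma cos_phase_neq_1: "1 \<le> n \<Longrightarrow> cos (phase n x) \<noteq> 1"
proof
  assume n: "1 \<le> n" and "cos (phase n x) = 1"
  then obtain k :: int where k: "phase n x = real_of_int k * 2 * pi" unfolding cos_one_2pi_int by blast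
  define w where "w = (\<Sum>j<n. winding (x (int j)))"
  have "(\<Sum>j<n. 1) \<le> w" unfolding w_def by (rule sum_mono) (simp add: winding_def)
  then have "w > 0" using n by simp
  moreover have "base_rate * w = k" using k by (simp add: phase_def w_def)
  ultimately have "base_rate = of_int k / of_nat w" by (simp add: field_simps)
  then have "base_rate \<in> \<rat>" by (metis Rats_divide Rats_of_int Rats_of_nat)
  then show False using base_rate_irrational by blast
qed

lemma phase_periodic:
  assumes "(left_shift ^^ n) x = x"
  shows "phase (j + n) x = phase j x + phase n x"
proof -
  have x: "x (i + int n) = x i" for i using left_shift_funpow[of n x i] assms by simp
  have "(\<Sum>i<j + n. winding (x (int i))) = (\<Sum>i<j. winding (x (int i))) + (\<Sum>i<n. winding (x (int i)))"
  proof (induction j)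
    case (Suc j)
    then show ?case using x[of "int j"] by simp
  qed simp
  then show ?thesis by (simp only: phase_def of_nat_add distrib_left)
qed

text \<open>
  The Birkhoff sums of a linear function over a nontrivial rotation are geometric sums and
  hence bounded. For the proof, rotating the sum by the phase of one period changes it only
  by boundary terms, whereas a nontrivial rotation moves every vector by a fixed proportion
  of its length.
\<close>

lemma drift_periodic_bounded:
  assumes "(left_shift ^^ n) x = x" "1 \<le> n"
  obtains R where "\<And>N. norm (drift N x) \<le> R"
proof -
  define a where "a j = rot (- phase j x) east" for j
  define \<kappa> where "\<kappa> = phase n x"
  define q where "q = sqrt (2 - 2 * cos \<kappa>)"
  have q: "q > 0" using cos_phase_neq_1[OF assms(2), of x] cos_le_one[of \<kappa>] by (simp add: q_def \<kappa>_def less_le)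
  \<comment> \<open>Both sides arise from the sum up to \<open>N + n\<close> by removing its first \<open>n\<close> terms.\<close>
  have shift: "(\<Sum>j<N. a (j + n)) = (\<Sum>j<N. a j) + (\<Sum>j<n. a (j + N)) - (\<Sum>j<n. a j)" for N
  proof (induction N)
    case (Suc N)
    have "(\<Sum>j<n. a (j + Suc N)) - (\<Sum>j<n. a (j + N)) = a (n + N) - a N"
      using sum_lessThan_telescope[of "\<lambda>j. a (j + N)" n] by (simp add: sum_subtractf)
    then have T: "(\<Sum>j<n. a (j + Suc N)) = (\<Sum>j<n. a (j + N)) + a (n + N) - a N"
      by (simp add: algebra_simps)
    show ?case unfolding sum.lessThan_Suc Suc T by (simp add: algebra_simps)
  qed simp
  have na: "norm (a j) = 1" for j by (simp add: a_def)
  have "q * norm (drift N x) \<le> 2 * n" for N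
  proof -
    have "rot (- \<kappa>) (drift N x) = (\<Sum>j<N. a (j + n))"
      by (simp add: drift_def linear_sum[OF linear_rot] rot_rot a_def phase_periodic[OF assms(1)] \<kappa>_def
          add.commute)
    then have d: "rot (- \<kappa>) (drift N x) - drift N x = (\<Sum>j<n. a (j + N)) - (\<Sum>j<n. a j)"
      using shift[of N] by (simp add: drift_def a_def)
    have "(q * norm (drift N x))\<^sup>2 = (norm (rot (- \<kappa>) (drift N x) - drift N x))\<^sup>2"
      using norm_rot_diff[of "- \<kappa>" "drift N x"] cos_le_one[of \<kappa>] by (simp add: q_def power_mult_distrib)
    then have "q * norm (drift N x) = norm (rot (- \<kappa>) (drift N x) - drift N x)"
      by (rule power2_eq_imp_eq) (use q in simp_all)
    also have "\<dots> \<le> norm (\<Sum>j<n. a (j + N)) + norm (\<Sum>j<n. a j)"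
      unfolding d by (rule norm_triangle_ineq4)
    also have "\<dots> \<le> n + n"
      using sum_norm_le[of "{..<n}" "\<lambda>j. a (j + N)" "\<lambda>j. 1"] sum_norm_le[of "{..<n}" a "\<lambda>j. 1"]
      by (simp add: na)
    finally show ?thesis by simp
  qed
  then show ?thesis using q by (intro that[of "2 * n / q"]) (simp add: field_simps)
qed

text \<open>
  Bounded drift bounds the differentials of all iterates and of their inverses, so the
  conclusion holds at every point of the fiber and not just almost everywhere.
\<close>

lemma periodic_zero_exponent:
  assumes g: "riemannian_metric g" and per: "(left_shift ^^ n) x = x" "1 \<le> n"
    and p: "p \<in> S3xS1" and v: "v \<in> tangent_space p" "v \<noteq> 0"
  shows "has_fiber_exponent g twist_cocycle x p v 0"
proof -
  obtain c C where cC: "0 < c" "0 < C"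
    "\<And>p v. p \<in> S3xS1 \<Longrightarrow> v \<in> tangent_space p \<Longrightarrow>
      c * norm v \<le> metric_norm g p v \<and> metric_norm g p v \<le> C * norm v"
    using metric_norm_comparable[OF g] by blast
  obtain R where R: "\<And>N. norm (drift N x) \<le> R"
    using drift_periodic_bounded[OF per] by blast
  have R0: "0 \<le> R" using R[of 0] norm_ge_zero order_trans by blast
  define D where "D N = twist_deriv (phase N x) (drift N x) p v" for N
  define Q where "Q N = metric_norm g (cocycle_iterate twist_cocycle N x p)
                (tangent_map (cocycle_iterate twist_cocycle N x) p v)" for N
  have D: "tangent_map (cocycle_iterate twist_cocycle N x) p v = D N" for N
    unfolding D_def by (rule tangent_map_eq_twist_deriv[OF _ p v(1)]) (rule cocycle_iterate_eq_twist)
  have Q: "c * norm (D N) \<le> Q N" "Q N \<le> C * norm (D N)" for N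
    using cC(3)[OF twist_in_S3xS1[OF p] twist_deriv_in_tangent_space[OF p v(1)], of "phase N x" "drift N x"]
    unfolding Q_def D cocycle_iterate_eq_twist[OF p] by (simp_all add: D_def)
  define U where "U = exp R + R + 1"
  define L where "L = exp R * (1 + R) + 1"
  have nv: "norm v > 0" using v by simp
  have L: "L > 0" using R0 by (simp add: L_def add_nonneg_pos)
  have "norm (D N) \<le> U * norm v" for N
  proof -
    have "exp (norm (drift N x)) + norm (drift N x) + 1 \<le> U"
      unfolding U_def using R[of N] by (intro add_mono) auto
    then show ?thesis
      using norm_twist_deriv_le[OF p v(1), of "phase N x" "drift N x"] nv
      unfolding D_def by (meson mult_right_mono norm_ge_zero order_trans)
  qed
  then have up: "Q N \<le> C * (U * norm v)" for N
    using Q(2)[of N] cC(2) by (meson mult_left_mono less_imp_le order_trans)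
  have "norm v \<le> L * norm (D N)" for N
  proof -
    have "exp (norm (drift N x)) * (1 + norm (drift N x)) + 1 \<le> L"
      unfolding L_def using R[of N] by (intro add_mono mult_mono) auto
    then show ?thesis
      using norm_le_twist_deriv[OF p v(1), of "drift N x" "phase N x"]
      unfolding D_def by (meson mult_right_mono norm_ge_zero order_trans)
  qed
  then have "norm v / L \<le> norm (D N)" for N using L by (simp add: field_simps)
  then have lo: "c * (norm v / L) \<le> Q N" for N
    using Q(1)[of N] cC(1) by (meson mult_left_mono less_imp_le order_trans)
  have lo0: "0 < c * (norm v / L)" using cC nv L by simp
  define K where "K = \<bar>ln (c * (norm v / L))\<bar> + \<bar>ln (C * (U * norm v))\<bar>"
  have "\<bar>ln (Q N)\<bar> \<le> K" for N
  proof -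
    have "0 < Q N" using lo0 lo[of N] by linarith
    then have "ln (c * (norm v / L)) \<le> ln (Q N)" "ln (Q N) \<le> ln (C * (U * norm v))"
      using lo[of N] up[of N] lo0 by (auto intro!: ln_mono)
    then show ?thesis unfolding K_def by linarith
  qed
  then have "norm (ln (Q N) / real N) \<le> K / real N" for N
    by (simp add: divide_right_mono)
  then have "(\<lambda>N. ln (Q N) / real N) \<longlonglongrightarrow> 0"
    by (intro Lim_null_comparison[OF always_eventually lim_const_over_n]) auto
  then show ?thesis by (simp add: has_fiber_exponent_def Q_def)
qed

section \<open>A Sturmian measure with a positive exponent\<close>

text \<open>
  A sequence that keeps the point of the circle in the right half plane is found greedily:
  rotate forward if the current angle is negative and backward otherwise. These two motions
  are the exchange of two intervals that make up the arc from
  \<open>- 2 * pi * (1 - 4 * base_rate)\<close> to \<open>2 * pi * base_rate\<close>. With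
  its ends identified and its length scaled to one, the arc is the circle of reals modulo
  one, the exchange is the rotation by \<open>sturm_rotation\<close>, and the resulting
  symbol sequence is Sturmian. Coding by \<open>frac\<close> also defines the symbols at
  negative times.
\<close>

definition sturm_rotation :: real where
  "sturm_rotation = base_rate / (1 - 3 * base_rate)"

definition sturm_angle :: "real \<Rightarrow> real" where
  "sturm_angle y = 2 * pi * (1 - 3 * base_rate) * frac y - 2 * pi * (1 - 4 * base_rate)"

definition sturm_code :: "real \<Rightarrow> int \<Rightarrow> nat" where
  "sturm_code y i = (if frac (y + of_int i * sturm_rotation) < 1 - sturm_rotation then 0 else 1)"

definition sturm_point :: "real \<Rightarrow> (int \<Rightarrow> nat) \<times> ambient" where
  "sturm_point y = (sturm_code y, (- pole, rot (sturm_angle y) east))"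

lemma sturm_rotation_bounds: "0 < sturm_rotation" "sturm_rotation < 1"
  using base_rate_bounds by (auto simp: sturm_rotation_def)

lemma frac_add_sturm_rotation:
  "frac (y + sturm_rotation) = (if frac y < 1 - sturm_rotation then frac y + sturm_rotation
     else frac y + sturm_rotation - 1)"
  using sturm_rotation_bounds frac_eq[of sturm_rotation] by (auto simp: frac_add)

lemma frac_frac_add: "frac (frac (y :: real) + z) = frac (y + z)"
proof -
  have "frac (x - of_int k) = frac x" for x :: real and k by (simp add: frac_def)
  from this[of "y + z" "\<lfloor>y\<rfloor>"] show ?thesis by (simp add: frac_def[of y] algebra_simps)
qed

lemma sturm_point_frac: "sturm_point (frac y) = sturm_point y"
  using frac_frac_add[of y 0]
  by (simp add: sturm_point_def sturm_angle_def sturm_code_def[abs_def] frac_frac_add)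

lemma sturm_code_shift: "sturm_code (y + sturm_rotation * of_nat j) i = sturm_code y (i + int j)"
  by (simp add: sturm_code_def algebra_simps)

lemma rot_sturm_step:
  "rot (2 * pi * base_rate * winding (sturm_code y 0)) (rot (sturm_angle y) east)
    = rot (sturm_angle (y + sturm_rotation)) east"
proof -
  define P where "P = 1 - 3 * base_rate"
  have P: "P > 0" using base_rate_bounds by (simp add: P_def)
  have a: "sturm_angle z = 2 * pi * P * frac z - 2 * pi * (1 - 4 * base_rate)" for z
    by (simp add: sturm_angle_def P_def)
  have Pr: "P * sturm_rotation = base_rate" using P by (simp add: sturm_rotation_def P_def)
  show ?thesis
  proof (cases "frac y < 1 - sturm_rotation")
    case True
    then have "sturm_angle (y + sturm_rotation) = 2 * pi * P * frac y + 2 * pi * (P * sturm_rotation)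
       - 2 * pi * (1 - 4 * base_rate)"
      unfolding a frac_add_sturm_rotation by (simp add: algebra_simps)
    then show ?thesis
      using True unfolding Pr by (simp add: rot_rot sturm_code_def winding_def a algebra_simps)
  next
    case False
    then have "sturm_angle (y + sturm_rotation) = 2 * pi * P * frac y + 2 * pi * (P * sturm_rotation)
       - 2 * pi * P - 2 * pi * (1 - 4 * base_rate)"
      unfolding a frac_add_sturm_rotation by (simp add: algebra_simps)
    \<comment> \<open>The second rotation goes backward only after a full turn is subtracted.\<close>
    then have "sturm_angle (y + sturm_rotation) =
       (2 * pi * base_rate * winding (sturm_code y 0) + sturm_angle y) + 2 * pi * of_int (- 1)"
      using False unfolding Pr by (simp add: sturm_code_def winding_def a P_def algebra_simps)
    then show ?thesis by (simp only: rot_plus_2pi_int rot_rot)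
  qed
qed

lemma suspension_sturm_point: "suspension twist_cocycle (sturm_point y) = sturm_point (y + sturm_rotation)"
  using sturm_code_shift[of y 1] rot_sturm_step[of y]
  by (simp add: suspension_def sturm_point_def twist_cocycle_def twist_def boost_minus_pole
      left_shift_def fun_eq_iff)

lemma rot_phase_sturm:
  "rot (phase j (sturm_code y)) (rot (sturm_angle y) east) = rot (sturm_angle (y + sturm_rotation * of_nat j)) east"
proof (induction j)
  case (Suc j)
  have "phase (Suc j) (sturm_code y) = 2 * pi * base_rate * winding (sturm_code (y + sturm_rotation * of_nat j) 0)
     + phase j (sturm_code y)"
    by (simp add: phase_def sturm_code_shift algebra_simps)
  then have "rot (phase (Suc j) (sturm_code y)) (rot (sturm_angle y) east)
    = rot (2 * pi * base_rate * winding (sturm_code (y + sturm_rotation * of_nat j) 0))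
       (rot (phase j (sturm_code y)) (rot (sturm_angle y) east))"
    by (simp add: rot_rot add.assoc)
  also have "\<dots> = rot (sturm_angle (y + sturm_rotation * of_nat j + sturm_rotation)) east"
    unfolding Suc by (rule rot_sturm_step)
  finally show ?case by (simp add: algebra_simps)
qed (simp add: phase_def)

lemma east_inner_rot: "east \<bullet> rot a east = cos a"
  by (simp add: east_def rot_def quarter_turn_def inner_vec_def sum_2 axis_def)

lemma drift_sturm:
  "drift n (sturm_code y) \<bullet> rot (sturm_angle y) east = (\<Sum>j<n. cos (sturm_angle (y + sturm_rotation * of_nat j)))"
  by (simp add: drift_inner rot_phase_sturm east_inner_rot)

text \<open>
  The whole arc lies in the open right half plane.
\<close>

lemma cos_sturm_angle_bound: obtains \<delta> where "0 < \<delta>" "\<And>y. \<delta> \<le> cos (sturm_angle y)"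
proof -
  define m where "m = max (2 * (pi * (1 - 4 * base_rate))) (2 * (pi * base_rate))"
  have "pi * (1 - 4 * base_rate) < pi * (1/4)" "pi * base_rate < pi * (1/4)"
    using base_rate_bounds by (auto intro!: mult_strict_left_mono)
  then have "2 * (pi * (1 - 4 * base_rate)) < pi / 2" "2 * (pi * base_rate) < pi / 2" by linarith+
  then have m: "m < pi / 2" by (simp only: m_def max_less_iff_conj)
  have b: "\<bar>sturm_angle y\<bar> \<le> m" for y
  proof -
    have "0 \<le> 2 * pi * (1 - 3 * base_rate) * frac y"
      using base_rate_bounds frac_ge_0[of y] by (intro mult_nonneg_nonneg) auto
    moreover have "2 * pi * (1 - 3 * base_rate) * frac y \<le> 2 * pi * (1 - 3 * base_rate) * 1"
      using base_rate_bounds frac_lt_1[of y] by (intro mult_left_mono) auto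
    ultimately show ?thesis
      unfolding sturm_angle_def m_def by (auto simp: abs_le_iff algebra_simps le_max_iff_disj)
  qed
  have m0: "0 \<le> m" using b[of 0] by linarith
  show ?thesis
  proof
    show "0 < cos m" using m m0 by (intro cos_gt_zero_pi) auto
    show "cos m \<le> cos (sturm_angle y)" for y
      using cos_monotone_0_pi_le[of "\<bar>sturm_angle y\<bar>" m] b[of y] m pi_gt_zero by simp
  qed
qed

definition unit_lebesgue :: "real measure" where
  "unit_lebesgue = uniform_measure lborel {0..<1}"

lemma sets_unit_lebesgue [simp, measurable_cong]: "sets unit_lebesgue = sets borel"
  and space_unit_lebesgue [simp]: "space unit_lebesgue = UNIV"
  by (simp_all add: unit_lebesgue_def)

lemma prob_space_unit_lebesgue: "prob_space unit_lebesgue"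
  unfolding unit_lebesgue_def by (rule prob_space_uniform_measure) auto

lemma measurable_frac [measurable]: "frac \<in> borel_measurable (borel :: real measure)"
  unfolding frac_def[abs_def] by measurable

text \<open>
  The rotation exchanges two intervals, and on each of them it is a translation.
\<close>

lemma distr_unit_lebesgue_rotation:
  assumes \<rho>: "0 < \<rho>" "\<rho> < 1"
  shows "distr unit_lebesgue borel (\<lambda>y. frac (y + \<rho>)) = unit_lebesgue"
proof (rule measure_eqI)
  fix A :: "real set" assume "A \<in> sets (distr unit_lebesgue borel (\<lambda>y. frac (y + \<rho>)))"
  then have A [measurable]: "A \<in> sets borel" by simp
  have trans: "emeasure lborel ((+) c -` B) = emeasure lborel B" if "B \<in> sets borel" for c :: real and B
  proof -
    have "emeasure (distr lborel borel ((+) c)) B = emeasure lborel ((+) c -` B)"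
      using that by (subst emeasure_distr) auto
    then show ?thesis by (simp add: lborel_distr_plus)
  qed
  have fr: "frac (y + \<rho>) = (if y < 1 - \<rho> then y + \<rho> else y + \<rho> - 1)" if "0 \<le> y" "y < 1" for y
    using that \<rho> frac_eq[of y] frac_eq[of \<rho>] by (auto simp: frac_add)
  have "{0..<1} \<inter> (\<lambda>y. frac (y + \<rho>)) -` A
    = (+) \<rho> -` (A \<inter> {\<rho>..<1}) \<union> (+) (\<rho> - 1) -` (A \<inter> {0..<\<rho>})" (is "?L = ?R")
  proof (rule set_eqI)
    fix y
    have e: "\<rho> - 1 + y = y + \<rho> - 1" "\<rho> + y = y + \<rho>" by simp_all
    show "y \<in> ?L \<longleftrightarrow> y \<in> ?R"
      using fr[of y] \<rho> unfolding vimage_def Int_iff Un_iff mem_Collect_eq e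
      by (cases "0 \<le> y \<and> y < 1"; cases "y < 1 - \<rho>") auto
  qed
  then have "emeasure lborel ({0..<1} \<inter> (\<lambda>y. frac (y + \<rho>)) -` A)
    = emeasure lborel ((+) \<rho> -` (A \<inter> {\<rho>..<1})) + emeasure lborel ((+) (\<rho> - 1) -` (A \<inter> {0..<\<rho>}))"
    using \<rho> by (simp add: plus_emeasure disjoint_iff)
  also have "\<dots> = emeasure lborel (A \<inter> {\<rho>..<1}) + emeasure lborel (A \<inter> {0..<\<rho>})"
    using trans[of "A \<inter> {\<rho>..<1}" \<rho>] trans[of "A \<inter> {0..<\<rho>}" "\<rho> - 1"]
    by (auto simp del: vimage_Int)
  also have "\<dots> = emeasure lborel ((A \<inter> {\<rho>..<1}) \<union> (A \<inter> {0..<\<rho>}))"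
    by (rule plus_emeasure) auto
  also have "(A \<inter> {\<rho>..<1}) \<union> (A \<inter> {0..<\<rho>}) = {0..<1} \<inter> A" using \<rho> by auto
  finally show "emeasure (distr unit_lebesgue borel (\<lambda>y. frac (y + \<rho>))) A = emeasure unit_lebesgue A"
    using measurable_sets[of "\<lambda>y. frac (y + \<rho>)" borel borel A]
    by (subst emeasure_distr) (auto simp: unit_lebesgue_def)
qed simp

text \<open>
  The Borel structure that \<open>invariant_prob\<close> prescribes for the alphabet with
  two symbols.
\<close>

definition phase_space :: "((int \<Rightarrow> nat) \<times> ambient) measure" where
  "phase_space = restrict_space borel (full_shift {0, 1} \<times> S3xS1)"

lemma space_phase_space: "space phase_space = full_shift {0, 1} \<times> S3xS1"
  by (simp add: phase_space_def space_restrict_space)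

lemma sturm_point_in: "sturm_point y \<in> full_shift {0, 1} \<times> S3xS1"
  by (simp add: sturm_point_def full_shift_def sturm_code_def S3xS1_def)

lemma measurable_sturm_point: "sturm_point \<in> measurable unit_lebesgue phase_space"
proof -
  have "sturm_code \<in> borel_measurable borel"
    by (rule measurable_coordinatewise_then_product) (simp add: sturm_code_def)
  moreover have "(\<lambda>y. rot (sturm_angle y) east) \<in> borel_measurable borel"
    unfolding rot_def sturm_angle_def by measurable
  ultimately have "sturm_point \<in> borel_measurable borel"
    unfolding sturm_point_def[abs_def] by (intro borel_measurable_Pair borel_measurable_const)
  then show ?thesis
    unfolding phase_space_def using sturm_point_in
    by (intro measurable_restrict_space2) (auto simp: measurable_cong_sets[OF sets_unit_lebesgue refl])
qed

definition sturm_measure :: "((int \<Rightarrow> nat) \<times> ambient) measure" where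
  "sturm_measure = distr unit_lebesgue phase_space sturm_point"

lemma measurable_suspension: "suspension twist_cocycle \<in> measurable phase_space phase_space"
proof -
  let ?X = "full_shift {0, 1} \<times> S3xS1"
  have coord: "continuous_on UNIV (\<lambda>x :: int \<Rightarrow> nat. x i)" for i
    by (rule continuous_on_product_coordinates)
  have shift: "continuous_on ?X (\<lambda>z. left_shift (fst z))"
    unfolding left_shift_def
    by (intro continuous_on_coordinatewise_then_product
        continuous_on_compose2[OF coord continuous_on_fst[OF continuous_on_id]]) auto
  have boost: "continuous_on ?X (\<lambda>z. fst (twist 0 east (snd z)))"
    by (intro continuous_on_fst continuous_on_compose2[OF continuous_on_twist continuous_on_snd[OF continuous_on_id]])
      auto
  have w: "continuous_on ?X (\<lambda>z. h (fst z 0))" for h :: "nat \<Rightarrow> real"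
  proof -
    have "continuous_on UNIV h" by simp
    then have "continuous_on UNIV (\<lambda>x :: int \<Rightarrow> nat. h (x 0))"
      by (rule continuous_on_compose2[OF _ coord]) auto
    then show ?thesis
      by (rule continuous_on_compose2[OF _ continuous_on_fst[OF continuous_on_id]]) auto
  qed
  have u: "continuous_on ?X (\<lambda>z. snd (snd z))"
    by (intro continuous_on_snd continuous_on_id)
  have "continuous_on UNIV quarter_turn"
    using linear_quarter_turn by (simp add: linear_continuous_on linear_linear)
  from continuous_on_compose2[OF this u]
  have q: "continuous_on ?X (\<lambda>z. quarter_turn (snd (snd z)))" by simp
  have "continuous_on ?X (\<lambda>z. rot (2 * pi * base_rate * winding (fst z 0)) (snd (snd z)))"
    unfolding rot_def
    by (intro continuous_on_add continuous_on_scaleR u q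
        w[of "\<lambda>s. cos (2 * pi * base_rate * winding s)"]
        w[of "\<lambda>s. sin (2 * pi * base_rate * winding s)"])
  with shift boost have "continuous_on ?X (\<lambda>z. (left_shift (fst z), (fst (twist 0 east (snd z)),
      rot (2 * pi * base_rate * winding (fst z 0)) (snd (snd z)))))"
    by (intro continuous_on_Pair)
  then have "continuous_on ?X (suspension twist_cocycle)"
    by (simp add: suspension_def twist_cocycle_def twist_def split_def)
  then show ?thesis
    unfolding phase_space_def
    by (intro measurable_restrict_space2 borel_measurable_continuous_on_restrict)
      (auto simp: space_restrict_space suspension_def full_shift_def left_shift_def twist_cocycle_def twist_in_S3xS1)
qed

lemma invariant_sturm_measure: "invariant_prob {0, 1} twist_cocycle sturm_measure"
proof -
  interpret prob_space unit_lebesgue by (rule prob_space_unit_lebesgue)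
  let ?T = "\<lambda>y. frac (y + sturm_rotation)"
  have "distr sturm_measure sturm_measure (suspension twist_cocycle)
    = distr sturm_measure phase_space (suspension twist_cocycle)"
    by (rule distr_cong) (simp_all add: sturm_measure_def)
  also have "\<dots> = distr unit_lebesgue phase_space (suspension twist_cocycle \<circ> sturm_point)"
    unfolding sturm_measure_def by (rule distr_distr[OF measurable_suspension measurable_sturm_point])
  also have "suspension twist_cocycle \<circ> sturm_point = sturm_point \<circ> ?T"
    by (simp add: fun_eq_iff suspension_sturm_point sturm_point_frac)
  also have "distr unit_lebesgue phase_space (sturm_point \<circ> ?T) = distr (distr unit_lebesgue borel ?T) phase_space sturm_point"
    by (rule distr_distr[symmetric]) (use measurable_sturm_point in \<open>auto simp: measurable_cong_sets[OF sets_unit_lebesgue refl]\<close>)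
  also have "\<dots> = sturm_measure"
    unfolding distr_unit_lebesgue_rotation[OF sturm_rotation_bounds] sturm_measure_def ..
  finally have "distr sturm_measure sturm_measure (suspension twist_cocycle) = sturm_measure" .
  moreover have "suspension twist_cocycle \<in> measurable sturm_measure sturm_measure"
    using measurable_suspension by (simp add: sturm_measure_def)
  ultimately show ?thesis
    unfolding invariant_prob_def
    using prob_space_distr[OF measurable_sturm_point]
    by (simp add: sturm_measure_def space_phase_space) (simp add: phase_space_def)
qed

text \<open>
  The iterate depends on the sequence through a cylinder only, so the superlevel sets of the
  norm are open relative to the product.
\<close>

lemma measurable_log_norm:
  assumes g: "riemannian_metric g"
  shows "(\<lambda>(x, p). ln (tangent_map_norm g (cocycle_iterate twist_cocycle n x) p)) \<in> borel_measurable phase_space"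
proof -
  let ?X = "full_shift {0, 1} \<times> S3xS1"
  define \<Phi> where "\<Phi> = (\<lambda>(x, p). tangent_map_norm g (cocycle_iterate twist_cocycle n x) p)"
  have \<Phi>: "\<Phi> (x, p) = tangent_map_norm g (twist (phase n y) (drift n y)) p"
    if "p \<in> S3xS1" "x \<in> cylinder n y" for x y p
    using tangent_map_norm_twist[OF cocycle_iterate_eq_twist that(1), of g n x]
      phase_cong[OF that(2) order_refl] drift_cong[OF that(2)] by (simp add: \<Phi>_def)
  have "\<Phi> \<in> borel_measurable phase_space"
  proof (rule borel_measurableI_greater)
    fix a
    have "\<exists>T. open T \<and> {p \<in> S3xS1. a < tangent_map_norm g (twist (phase n y) (drift n y)) p} = T \<inter> S3xS1" for y
      by (rule open_tangent_map_norm_greater[OF g, of a "phase n y" "drift n y"]) blast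
    then obtain T where T: "\<And>y. open (T y)"
      "\<And>y. {p \<in> S3xS1. a < tangent_map_norm g (twist (phase n y) (drift n y)) p} = T y \<inter> S3xS1"
      by metis
    have mem: "a < \<Phi> (x, p) \<longleftrightarrow> p \<in> T y" if "p \<in> S3xS1" "x \<in> cylinder n y" for x y p
      using T(2)[of y] that(1) unfolding \<Phi>[OF that] by blast
    have "x \<in> cylinder n x" for x by (simp add: cylinder_def)
    then have "{z \<in> space phase_space. a < \<Phi> z} = ?X \<inter> (\<Union>y. cylinder n y \<times> T y)"
      using mem unfolding space_phase_space by blast
    moreover have "open (\<Union>y. cylinder n y \<times> T y)"
      by (intro open_UN ballI open_Times open_cylinder T)
    ultimately show "{z \<in> space phase_space. a < \<Phi> z} \<in> sets phase_space"
      unfolding phase_space_def sets_restrict_space by auto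
  qed
  then have "(\<lambda>z. ln (\<Phi> z)) \<in> borel_measurable phase_space" by measurable
  then show ?thesis by (simp add: \<Phi>_def split_def)
qed

lemma integral_rotation:
  fixes h :: "real \<Rightarrow> real"
  assumes [measurable]: "h \<in> borel_measurable borel" and h: "\<And>y. h (frac y) = h y"
    and \<rho>: "0 < \<rho>" "\<rho> < 1"
  shows "(\<integral>y. h (y + \<rho>) \<partial>unit_lebesgue) = (\<integral>y. h y \<partial>unit_lebesgue)"
proof -
  have "(\<integral>y. h y \<partial>unit_lebesgue) = (\<integral>y. h y \<partial>distr unit_lebesgue borel (\<lambda>y. frac (y + \<rho>)))"
    by (simp add: distr_unit_lebesgue_rotation[OF \<rho>])
  also have "\<dots> = (\<integral>y. h (frac (y + \<rho>)) \<partial>unit_lebesgue)"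
    by (rule integral_distr) measurable
  finally show ?thesis by (simp add: h)
qed

text \<open>
  Along the coded orbit the boosting times are Birkhoff sums of the positive function
  \<open>cos \<circ> sturm_angle\<close>, and the logarithmic norm differs from them by a
  bounded amount. Invariance makes the integral of each Birkhoff sum proportional to its
  length.
\<close>

lemma top_exponent_sturm_measure:
  assumes g: "riemannian_metric g"
  shows "has_top_fiber_exponent g twist_cocycle sturm_measure (\<integral>y. cos (sturm_angle y) \<partial>unit_lebesgue)"
proof -
  interpret prob_space unit_lebesgue by (rule prob_space_unit_lebesgue)
  define l where "l = (\<integral>y. cos (sturm_angle y) \<partial>unit_lebesgue)"
  obtain B where B: "\<And>\<theta> l p. p \<in> S3xS1 \<Longrightarrow> fst p = - pole \<Longrightarrow> 0 \<le> l \<bullet> snd p \<Longrightarrow>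
    \<bar>ln (tangent_map_norm g (twist \<theta> l) p) - l \<bullet> snd p\<bar> \<le> B"
    using tangent_map_norm_at_minus_pole[OF g] by blast
  obtain \<delta> where \<delta>: "0 < \<delta>" "\<And>y. \<delta> \<le> cos (sturm_angle y)"
    using cos_sturm_angle_bound by blast
  define F where "F n z = (case z of (x, p) \<Rightarrow> ln (tangent_map_norm g (cocycle_iterate twist_cocycle n x) p))" for n z
  define L where "L n y = (\<Sum>j<n. cos (sturm_angle (y + sturm_rotation * of_nat j)))" for n y
  have mF: "(\<lambda>y. F n (sturm_point y)) \<in> borel_measurable unit_lebesgue" for n
    using measurable_compose[OF measurable_sturm_point measurable_log_norm[OF g, of n]]
    by (simp add: F_def)
  have ma [measurable]: "sturm_angle \<in> borel_measurable borel"
    unfolding sturm_angle_def[abs_def] by measurable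
  have FL: "\<bar>F n (sturm_point y) - L n y\<bar> \<le> B" for n y
  proof -
    let ?x = "sturm_code y" and ?p = "(- pole, rot (sturm_angle y) east) :: ambient"
    have p: "?p \<in> S3xS1" by (simp add: S3xS1_def)
    have L: "drift n ?x \<bullet> snd ?p = L n y" by (simp add: drift_sturm L_def)
    have "0 \<le> L n y" unfolding L_def using \<delta> by (intro sum_nonneg) (meson less_imp_le order_trans)
    then have "\<bar>ln (tangent_map_norm g (twist (phase n ?x) (drift n ?x)) ?p) - L n y\<bar> \<le> B"
      using B[OF p, of "drift n ?x" "phase n ?x"] unfolding L by simp
    then show ?thesis
      using tangent_map_norm_twist[OF cocycle_iterate_eq_twist p, of g n ?x]
      by (simp add: F_def sturm_point_def)
  qed
  have int_cos: "integrable unit_lebesgue (\<lambda>y. cos (sturm_angle (y + c)))" for c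
    by (rule integrable_const_bound[of _ 1]) auto
  have shift: "(\<integral>y. cos (sturm_angle (y + sturm_rotation * of_nat j)) \<partial>unit_lebesgue) = l" for j
  proof (induction j)
    case (Suc j)
    have "(\<integral>y. cos (sturm_angle (y + sturm_rotation + sturm_rotation * of_nat j)) \<partial>unit_lebesgue)
      = (\<integral>y. cos (sturm_angle (y + sturm_rotation * of_nat j)) \<partial>unit_lebesgue)"
      by (rule integral_rotation[OF _ _ sturm_rotation_bounds]) (simp_all add: sturm_angle_def frac_frac_add)
    with Suc show ?case by (simp add: algebra_simps)
  qed (simp add: l_def)
  have intL: "integrable unit_lebesgue (L n)" and L: "(\<integral>y. L n y \<partial>unit_lebesgue) = n * l" for n
    unfolding L_def using int_cos by (simp_all add: shift)
  have Bn: "\<bar>(\<integral>z. F n z \<partial>sturm_measure) - n * l\<bar> \<le> B" for n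
  proof -
    have e: "(\<integral>z. F n z \<partial>sturm_measure) = (\<integral>y. F n (sturm_point y) \<partial>unit_lebesgue)"
      unfolding sturm_measure_def
      by (rule integral_distr[OF measurable_sturm_point]) (use measurable_log_norm[OF g, of n] in \<open>simp add: F_def\<close>)
    have intD: "integrable unit_lebesgue (\<lambda>y. F n (sturm_point y) - L n y)"
      by (rule integrable_const_bound[of _ B])
        (use FL in \<open>auto intro!: borel_measurable_diff mF borel_measurable_integrable[OF intL]\<close>)
    have "(\<integral>y. F n (sturm_point y) - L n y \<partial>unit_lebesgue) + (\<integral>y. L n y \<partial>unit_lebesgue)
      = (\<integral>y. F n (sturm_point y) \<partial>unit_lebesgue)"
      by (subst Bochner_Integration.integral_add[OF intD intL, symmetric]) simp
    moreover have "\<bar>\<integral>y. F n (sturm_point y) - L n y \<partial>unit_lebesgue\<bar> \<le> B"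
    proof -
      have "\<bar>\<integral>y. F n (sturm_point y) - L n y \<partial>unit_lebesgue\<bar> \<le> (\<integral>y. \<bar>F n (sturm_point y) - L n y\<bar> \<partial>unit_lebesgue)"
        by (rule integral_abs_bound)
      also have "\<dots> \<le> B"
        by (rule integral_le_const) (use FL integrable_abs[OF intD] in auto)
      finally show ?thesis .
    qed
    ultimately show ?thesis by (simp add: e L)
  qed
  have "(\<lambda>n. (\<integral>z. F n z \<partial>sturm_measure) / real n - l) \<longlonglongrightarrow> 0"
  proof (rule Lim_null_comparison[OF _ lim_const_over_n[of B]])
    show "\<forall>\<^sub>F n in sequentially. norm ((\<integral>z. F n z \<partial>sturm_measure) / real n - l) \<le> B / real n"
      using eventually_gt_at_top[of 0]
    proof eventually_elim
      case (elim n)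
      then have "(\<integral>z. F n z \<partial>sturm_measure) / real n - l = ((\<integral>z. F n z \<partial>sturm_measure) - n * l) / n"
        by (simp add: field_simps)
      then show ?case using Bn[of n] elim by (simp add: divide_right_mono)
    qed
  qed
  then show ?thesis
    unfolding has_top_fiber_exponent_def F_def l_def by (simp add: LIM_zero_iff)
qed

lemma top_exponent_positive: "0 < (\<integral>y. cos (sturm_angle y) \<partial>unit_lebesgue)"
proof -
  interpret prob_space unit_lebesgue by (rule prob_space_unit_lebesgue)
  obtain \<delta> where \<delta>: "0 < \<delta>" "\<And>y. \<delta> \<le> cos (sturm_angle y)"
    using cos_sturm_angle_bound by blast
  have [measurable]: "sturm_angle \<in> borel_measurable borel"
    unfolding sturm_angle_def[abs_def] by measurable
  have "\<delta> \<le> (\<integral>y. cos (sturm_angle y) \<partial>unit_lebesgue)"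
    by (rule integral_ge_const) (use \<delta> in \<open>auto intro!: integrable_const_bound[of _ 1]\<close>)
  with \<delta> show ?thesis by linarith
qed

section \<open>Failure of approximation by periodic orbits\<close>

lemma zero_exponents_over_periodic_orbits:
  assumes g: "riemannian_metric g" and \<nu>: "invariant_prob S twist_cocycle \<nu>"
    and supp: "supported_over_periodic_orbit S \<nu>"
  shows "zero_fiber_exponents g twist_cocycle \<nu>"
proof -
  obtain x n where n: "1 \<le> n" "(left_shift ^^ n) x = x"
    and AEx: "AE y in distr \<nu> borel fst. y \<in> {(left_shift ^^ k) x | k. k < n}"
    using supp unfolding supported_over_periodic_orbit_def by blast
  have \<nu>': "space \<nu> = full_shift S \<times> S3xS1" "sets \<nu> = sets (restrict_space borel (full_shift S \<times> S3xS1))"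
    using \<nu> by (auto simp: invariant_prob_def)
  have "fst \<in> measurable \<nu> borel"
    unfolding measurable_cong_sets[OF \<nu>'(2) refl]
    by (intro borel_measurable_continuous_on_restrict continuous_on_fst continuous_on_id)
  from AE_distrD[OF this AEx] have "AE z in \<nu>. fst z \<in> {(left_shift ^^ k) x | k. k < n}" .
  then have "AE z in \<nu>. \<forall>v\<in>tangent_space (snd z) - {0}. has_fiber_exponent g twist_cocycle (fst z) (snd z) v 0"
    using AE_space
  proof eventually_elim
    case (elim z)
    then obtain k where k: "fst z = (left_shift ^^ k) x" by blast
    have "(left_shift ^^ n) (fst z) = (left_shift ^^ k) ((left_shift ^^ n) x)"
      unfolding k by (simp flip: funpow_add comp_apply[of "left_shift ^^ _"] add: add.commute)
    then have "(left_shift ^^ n) (fst z) = fst z" using n k by simp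
    moreover have "snd z \<in> S3xS1" using elim \<nu>' by auto
    ultimately show ?case using periodic_zero_exponent[OF g _ n(1)] by blast
  qed
  then show ?thesis by (simp add: zero_fiber_exponents_def split_def)
qed

theorem theorem1p7:
  fixes g :: "ambient \<Rightarrow> ambient \<Rightarrow> ambient \<Rightarrow> real"
  assumes "riemannian_metric g"
  shows "\<exists>(S :: nat set) (A :: cocycle).
           finite S \<and>
           locally_constant_cocycle S A \<and>
           (\<exists>\<mu> l. invariant_prob S A \<mu> \<and> has_top_fiber_exponent g A \<mu> l \<and> l \<noteq> 0) \<and>
           (\<forall>\<nu>. invariant_prob S A \<nu> \<and> supported_over_periodic_orbit S \<nu> \<longrightarrow>
                  zero_fiber_exponents g A \<nu>)"
proof (intro exI conjI allI impI)
  show "finite {0, 1 :: nat}" by simp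
  show "locally_constant_cocycle {0, 1} twist_cocycle" by (rule locally_constant_twist_cocycle)
  show "invariant_prob {0, 1} twist_cocycle sturm_measure" by (rule invariant_sturm_measure)
  show "has_top_fiber_exponent g twist_cocycle sturm_measure (\<integral>y. cos (sturm_angle y) \<partial>unit_lebesgue)"
    by (rule top_exponent_sturm_measure[OF assms])
  show "(\<integral>y. cos (sturm_angle y) \<partial>unit_lebesgue) \<noteq> 0" using top_exponent_positive by simp
  show "zero_fiber_exponents g twist_cocycle \<nu>"
    if "invariant_prob {0, 1} twist_cocycle \<nu> \<and> supported_over_periodic_orbit {0, 1} \<nu>" for \<nu>
    using that zero_exponents_over_periodic_orbits[OF assms] by blast
qed

end
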